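(* Let $p\ge1$, $q=p/(p-1)$, $\nu<1$. Then the index transform $$(Ff)(\tau)=\int_0^\infty\left[\mathrm{ker}^2_{2i\tau}\left(2(4x)^{1/4}\right)+\mathrm{kei}^2_{2i\tau}\left(2(4x)^{1/4}\right)\right]f(x)\,dx,\qquad \tau\in\mathbb{R}_+,$$ is well defined as a bounded operator $F:L_{\nu,p}(\mathbb{R}_+)\to C_b(\mathbb{R}_+)$, and for all $f\in L_{\nu,p}(\mathbb{R}_+)$ the following norm inequality holds: $$\|Ff\|_{C_b(\mathbb{R}_+)}\le 4^{\nu-3+1/q}\,q^{4(\nu-1)}\,\Gamma^{1/q}\left(4(1-\nu)q\right)\,B(1-\nu,1-\nu)\,B\left(2(1-\nu),2(1-\nu)\right)\,\|f\|_{\nu,p}.$$ Moreover, $(Ff)(\tau)\to0$ as $\tau\to+\infty$.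
   Context: $\mathbb{R}_+=(0,\infty)$. $L_{\nu,p}(\mathbb{R}_+)$ ($\nu\in\mathbb{R}$, $1\le p<\infty$) is the space of complex-valued measurable functions $f$ on $\mathbb{R}_+$ with finite norm $\|f\|_{\nu,p}=\left(\int_0^\infty|f(x)|^px^{\nu p-1}dx\right)^{1/p}$. $C_b(\mathbb{R}_+)$ is the space of bounded continuous functions on $\mathbb{R}_+$ with the supremum norm. $\Gamma$ is Euler's gamma function and $B(a,b)$ is Euler's beta function. For $p=1$ (so $q=\infty$) the constant in the inequality is understood as its limit as $q\to\infty$. $K_\nu(z)$ is the modified Bessel function of the second kind, $K_\nu(z)=\int_0^\infty e^{-z\cosh y}\cosh(\nu y)\,dy$ for $\mathrm{Re}\,z>0$ and complex $\nu$. The Kelvin functions $\mathrm{ker}_\nu(x),\mathrm{kei}_\nu(x)$ ($x>0$, $\nu\in\mathbb{C}$) are defined by the pair of equations $\mathrm{ker}_\nu(x)\pm i\,\mathrm{kei}_\nu(x)=e^{\mp\nu\pi i/2}K_\nu\left(xe^{\pm\pi i/4}\right)$. *)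

theory Defs
  imports "HOL-Analysis.Analysis"
begin

definition bessel_K :: "complex \<Rightarrow> complex \<Rightarrow> complex" where
  "bessel_K \<mu> z = (LBINT y:{0<..}. exp (- z * cosh (of_real y)) * cosh (\<mu> * of_real y))"

text \<open>
  The Kelvin functions are given by the equations
  \<open>ker \<plusminus> \<i> kei = exp (\<mp> \<mu> \<pi> \<i> / 2) K\<^sub>\<mu>(x exp (\<plusminus> \<pi> \<i> / 4))\<close>, solved here for the two unknowns;
  \<open>kelvin_equations_iff\<close> states that they are the unique solution. For complex order they are
  in general not real.
\<close>

definition kelvin_ker :: "complex \<Rightarrow> real \<Rightarrow> complex" where
  "kelvin_ker \<mu> x =
    (exp (- (\<mu> * of_real pi * \<i> / 2)) * bessel_K \<mu> (of_real x * exp (of_real pi * \<i> / 4)) +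
     exp (\<mu> * of_real pi * \<i> / 2) * bessel_K \<mu> (of_real x * exp (- (of_real pi * \<i> / 4)))) / 2"

definition kelvin_kei :: "complex \<Rightarrow> real \<Rightarrow> complex" where
  "kelvin_kei \<mu> x =
    (exp (- (\<mu> * of_real pi * \<i> / 2)) * bessel_K \<mu> (of_real x * exp (of_real pi * \<i> / 4)) -
     exp (\<mu> * of_real pi * \<i> / 2) * bessel_K \<mu> (of_real x * exp (- (of_real pi * \<i> / 4)))) / (2 * \<i>)"

lemma kelvin_equations_iff:
  fixes a b \<mu> :: complex and x :: real
  shows "a + \<i> * b =
     exp (- (\<mu> * of_real pi * \<i> / 2)) * bessel_K \<mu> (of_real x * exp (of_real pi * \<i> / 4)) \<and>
   a - \<i> * b =
     exp (\<mu> * of_real pi * \<i> / 2) * bessel_K \<mu> (of_real x * exp (- (of_real pi * \<i> / 4)))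
   \<longleftrightarrow> a = kelvin_ker \<mu> x \<and> b = kelvin_kei \<mu> x"
proof -
  have *: "a + \<i> * b = A \<and> a - \<i> * b = B \<longleftrightarrow> a = (A + B) / 2 \<and> b = (A - B) / (2 * \<i>)"
    for A B :: complex
  proof -
    have "(A - B) / (2 * \<i>) = - \<i> * (A - B) / 2"
      by (simp add: field_simps)
    then show ?thesis
      by (auto simp: complex_eq_iff field_simps)
  qed
  show ?thesis
    unfolding kelvin_ker_def kelvin_kei_def by (rule *)
qed

text \<open>
  The space \<open>L\<^bsub>\<nu>,p\<^esub>(0,\<infinity>)\<close>, as a set of functions rather than of classes modulo
  almost everywhere equality. Values outside of \<open>{0<..}\<close> are irrelevant.
\<close>

definition weighted_Lp :: "real \<Rightarrow> real \<Rightarrow> (real \<Rightarrow> complex) set" where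
  "weighted_Lp \<nu> p =
    {f. set_borel_measurable lebesgue {0<..} f \<and>
        set_integrable lebesgue {0<..} (\<lambda>x. norm (f x) powr p * x powr (\<nu> * p - 1))}"

definition weighted_Lp_norm :: "real \<Rightarrow> real \<Rightarrow> (real \<Rightarrow> complex) \<Rightarrow> real" where
  "weighted_Lp_norm \<nu> p f =
    (LINT x:{0<..}|lebesgue. norm (f x) powr p * x powr (\<nu> * p - 1)) powr (1 / p)"

definition Cb_pos :: "(real \<Rightarrow> complex) set" where
  "Cb_pos = {g. continuous_on {0<..} g \<and> bounded (g ` {0<..})}"

definition Cb_pos_norm :: "(real \<Rightarrow> complex) \<Rightarrow> real" where
  "Cb_pos_norm g = (SUP \<tau>\<in>{0<..}. norm (g \<tau>))"

text \<open>
  Since \<open>weighted_Lp\<close> consists of functions, an operator on the space of classes has to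
  respect almost everywhere equality.
\<close>

definition bounded_operator_Lp_Cb ::
    "real \<Rightarrow> real \<Rightarrow> ((real \<Rightarrow> complex) \<Rightarrow> real \<Rightarrow> complex) \<Rightarrow> bool" where
  "bounded_operator_Lp_Cb \<nu> p T \<longleftrightarrow>
    (\<forall>f\<in>weighted_Lp \<nu> p. T f \<in> Cb_pos) \<and>
    (\<forall>f\<in>weighted_Lp \<nu> p. \<forall>g\<in>weighted_Lp \<nu> p.
       (AE x in lebesgue. 0 < x \<longrightarrow> f x = g x) \<longrightarrow> (\<forall>\<tau>>0. T f \<tau> = T g \<tau>)) \<and>
    (\<forall>f\<in>weighted_Lp \<nu> p. \<forall>g\<in>weighted_Lp \<nu> p. \<forall>a b. \<forall>\<tau>>0.
       T (\<lambda>x. a * f x + b * g x) \<tau> = a * T f \<tau> + b * T g \<tau>) \<and>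
    (\<exists>C. \<forall>f\<in>weighted_Lp \<nu> p. Cb_pos_norm (T f) \<le> C * weighted_Lp_norm \<nu> p f)"

definition kelvin_kernel :: "real \<Rightarrow> real \<Rightarrow> complex" where
  "kelvin_kernel \<tau> x =
    (kelvin_ker (2 * \<i> * of_real \<tau>) (2 * (4 * x) powr (1/4)))\<^sup>2 +
    (kelvin_kei (2 * \<i> * of_real \<tau>) (2 * (4 * x) powr (1/4)))\<^sup>2"

definition index_transform :: "(real \<Rightarrow> complex) \<Rightarrow> real \<Rightarrow> complex" where
  "index_transform f \<tau> = (LINT x:{0<..}|lebesgue. kelvin_kernel \<tau> x * f x)"

definition index_const_q :: "real \<Rightarrow> real \<Rightarrow> real" where
  "index_const_q \<nu> q =
    4 powr (\<nu> - 3 + 1 / q) * q powr (4 * (\<nu> - 1)) * Gamma (4 * (1 - \<nu>) * q) powr (1 / q) *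
    Beta (1 - \<nu>) (1 - \<nu>) * Beta (2 * (1 - \<nu>)) (2 * (1 - \<nu>))"

text \<open>For \<open>p = 1\<close> the conjugate exponent is infinite and the constant is the limit in \<open>q\<close>.\<close>

definition index_const :: "real \<Rightarrow> real \<Rightarrow> real" where
  "index_const \<nu> p =
    (if p = 1 then Lim at_top (\<lambda>q. index_const_q \<nu> q) else index_const_q \<nu> (p / (p - 1)))"

end

theory Submission
  imports Defs "HOL-Complex_Analysis.Complex_Analysis" "HOL-Real_Asymp.Real_Asymp"
begin

text \<open>
  The kernel is \<open>K\<^sub>\<mu>(X) K\<^sub>\<mu>(Y)\<close> with \<open>\<mu> = 2\<i>\<tau>\<close> and conjugate arguments \<open>X\<close>, \<open>Y\<close>. Writing both
  factors as integrals of \<open>exp (- X cosh a + \<mu> a)\<close> over the line, substituting \<open>a = u/2 + d\<close>,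
  \<open>b = u/2 - d\<close> and shifting the contour in \<open>d\<close> removes the oscillation in \<open>d\<close> and gives
  \<open>1/4 \<integral>\<integral> exp (2\<i>\<tau>u) exp (- 4 x\<^bsup>1/4\<^esup> \<surd>(cosh u) cosh v) dv du\<close>.
  Dropping the factor \<open>exp (2\<i>\<tau>u)\<close> yields a majorant independent of \<open>\<tau>\<close>. Fubini, Hoelder's
  inequality in \<open>x\<close> for fixed \<open>u\<close>, \<open>v\<close> (a Gamma integral) and
  \<open>\<integral> cosh\<^bsup>-a\<^esup> = 2\<^bsup>a-1\<^esup> B(a/2,a/2)\<close> then give exactly the stated constant. Continuity and the decay
  as \<open>\<tau> \<rightarrow> \<infinity>\<close> follow by dominated convergence with the same majorant.
\<close>

section \<open>Gamma and Beta integrals\<close>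

lemma Beta_real_nonneg:
  fixes a b :: real
  assumes "0 < a" "0 < b"
  shows "0 \<le> Beta a b"
  using assms unfolding Beta_def
  by (intro divide_nonneg_nonneg mult_nonneg_nonneg less_imp_le Gamma_real_pos) auto

text \<open>The change of variables for Lebesgue integrals asks for absolute integrability. A
  nonnegative integrand with a gauge integral has it, so the \<open>has_integral\<close> facts for
  the Gamma and Beta integrals can be transformed directly.\<close>

lemma has_integral_change_of_variables_nonneg:
  fixes f g g' :: "real \<Rightarrow> real"
  assumes "S \<in> sets lebesgue"
    and "\<And>x. x \<in> S \<Longrightarrow> (g has_field_derivative g' x) (at x within S)"
    and "inj_on g S"
    and "\<And>y. y \<in> g ` S \<Longrightarrow> 0 \<le> f y"
    and "(f has_integral I) (g ` S)"
  shows "((\<lambda>x. \<bar>g' x\<bar> * f (g x)) has_integral I) S"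
proof -
  have "f absolutely_integrable_on (g ` S) \<and> integral (g ` S) f = I"
    using assms(4,5) by (auto intro: nonnegative_absolutely_integrable_1)
  with has_absolute_integral_change_of_variables_1'[OF assms(1-3), of f I]
  show ?thesis
    by (auto simp: has_integral_integrable_integral intro: set_lebesgue_integral_eq_integral)
qed

text \<open>Substitute \<open>t = b * x powr (1/4)\<close> in the Gamma integral of parameter
  \<open>4 * a\<close>. This later gives the dual norm in Hoelder's inequality exactly.\<close>

lemma nn_integral_exp_root4:
  fixes a b :: real
  assumes "0 < a" "0 < b"
  shows "(\<integral>\<^sup>+x. ennreal (exp (- (b * x powr (1/4))) * x powr (a - 1)) * indicator {0<..} x \<partial>lborel)
    = ennreal (4 * Gamma (4 * a) * b powr (- (4 * a)))"
proof -
  let ?f = "\<lambda>t. t powr (4 * a - 1) / exp t"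
  let ?g = "\<lambda>x. b * x powr (1/4)"
  have im: "?g ` {0<..} = {0<..}"
  proof -
    have "y \<in> ?g ` {0<..}" if "y > 0" for y
    proof (rule image_eqI)
      have "((y / b) powr 4) powr (1/4) = y / b"
        using that assms by (simp only: powr_powr) simp
      then show "y = ?g ((y / b) powr 4)"
        using assms by simp
    qed (use that assms in auto)
    then show ?thesis using assms by auto
  qed
  have inj: "inj_on ?g {0<..}"
  proof (rule linorder_inj_onI')
    fix x y :: real assume "x \<in> {0<..}" "x < y"
    then show "?g x \<noteq> ?g y"
      using assms powr_less_mono2[of "1/4" x y] by auto
  qed
  have "(?f has_integral Gamma (4*a)) {0..}"
    using Gamma_integral_real[of "4*a"] assms by simp
  then have "(?f has_integral Gamma (4*a)) {0<..}"
    by (subst has_integral_spike_set_eq[of _ "{0..}"])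
       (auto intro: negligible_subset[OF negligible_sing[of 0]])
  then have "((\<lambda>x. \<bar>b * (1/4 * x powr (1/4 - 1))\<bar> * ?f (?g x)) has_integral Gamma (4*a)) {0<..}"
    using assms
    by (intro has_integral_change_of_variables_nonneg[where f = ?f and g = ?g])
       (auto simp: im inj intro!: derivative_eq_intros)
  \<comment> \<open>The transformed integrand is \<open>b powr (4 * a) / 4\<close> times the wanted
    one; the new factor clears this.\<close>
  then have "((\<lambda>x. (4 * b powr (- (4*a))) * (\<bar>b * (1/4 * x powr (1/4 - 1))\<bar> * ?f (?g x))) has_integral
     (4 * b powr (- (4*a))) * Gamma (4*a)) {0<..}"
    by (rule has_integral_mult_right)
  then have "((\<lambda>x. exp (- (b * x powr (1/4))) * x powr (a - 1)) has_integral
     4 * Gamma (4*a) * b powr (- (4*a))) {0<..}"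
  proof (rule back_subst[where P = "\<lambda>c. (_ has_integral c) _", OF has_integral_eq[rotated]])
    fix x :: real assume "x \<in> {0<..}"
    then have x: "x > 0" by simp
    have "b * (b * x powr (1/4)) powr (4 * a - 1) * x powr (1/4 - 1)
        = (b * b powr (4 * a - 1)) * (x powr (1/4 * (4 * a - 1)) * x powr (1/4 - 1))"
      using x assms by (simp add: powr_mult powr_powr)
    also have "\<dots> = b powr (4 * a) * x powr (1/4 * (4 * a - 1) + (1/4 - 1))"
      using x assms by (simp add: powr_mult_base flip: powr_add)
    also have "1/4 * (4 * a - 1) + (1/4 - 1) = a - 1"
      by (simp add: diff_divide_distrib)
    finally have *: "b * (b * x powr (1/4)) powr (4 * a - 1) * x powr (1/4 - 1)
        = b powr (4 * a) * x powr (a - 1)" .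
    have "(4 * b powr - (4 * a)) * (\<bar>b * (1/4 * x powr (1/4 - 1))\<bar> * ?f (?g x))
       = b powr - (4 * a) * (b * (b * x powr (1/4)) powr (4 * a - 1) * x powr (1/4 - 1)) / exp (b * x powr (1/4))"
      using x assms by (simp add: abs_mult)
    also have "\<dots> = exp (- (b * x powr (1/4))) * x powr (a - 1)"
      unfolding * using assms by (simp add: exp_minus powr_minus field_simps)
    finally show "(4 * b powr - (4 * a)) * (\<bar>b * (1/4 * x powr (1/4 - 1))\<bar> * ?f (?g x))
       = exp (- (b * x powr (1/4))) * x powr (a - 1)" .
  qed auto
  then show ?thesis
    by (intro nn_integral_has_integral_lebesgue') auto
qed

text \<open>The logistic substitution \<open>t = g y\<close> satisfies
  \<open>t * (1 - t) = 1 / (2 * cosh y)^2\<close> and has derivative \<open>2 * t * (1 - t)\<close>,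
  so the symmetric Beta integrand with parameter \<open>a / 2\<close> becomes
  \<open>2 * (2 * cosh y) powr - a\<close>.\<close>

lemma nn_integral_cosh_powr:
  fixes a :: real
  assumes "0 < a"
  shows "(\<integral>\<^sup>+y. ennreal (cosh y powr - a) \<partial>lborel) = ennreal (2 powr (a - 1) * Beta (a/2) (a/2))"
proof -
  define g where "g = (\<lambda>y::real. 1 / (1 + exp (- (2*y))))"
  let ?f = "\<lambda>t. t powr (a/2 - 1) * (1 - t) powr (a/2 - 1)"
  have im: "g ` UNIV = {0<..<1}"
  proof -
    have "y \<in> g ` UNIV" if "0 < y" "y < 1" for y
      using that by (intro image_eqI[of _ _ "- (ln (1 / y - 1) / 2)"]) (auto simp: g_def)
    moreover have "0 < g y \<and> g y < 1" for y unfolding g_def by (auto simp: add_pos_pos)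
    ultimately show ?thesis by auto
  qed
  have inj: "inj g" by (auto simp: inj_def g_def)
  have g1: "g y = exp y / (2 * cosh y)" "1 - g y = exp (-y) / (2 * cosh y)" for y
  proof -
    have e: "exp (- (2 * y)) = exp (- y) * exp (- y)" "exp y = 1 / exp (- y)"
      by (simp add: mult_exp_exp, simp add: exp_minus inverse_eq_divide)
    have "0 < 1 + exp (- y) * exp (- y)" by (simp add: add_pos_pos)
    then show "g y = exp y / (2 * cosh y)" "1 - g y = exp (-y) / (2 * cosh y)"
      unfolding g_def cosh_field_def e by (simp_all add: field_simps)
  qed
  have g2: "g y * (1 - g y) = 1 / (2 * cosh y)^2" for y
    unfolding g1(2) unfolding g1(1) by (simp add: power2_eq_square mult_exp_exp)
  have "(?f has_integral Beta (a/2) (a/2)) {0..1}"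
    using has_integral_Beta_real[of "a/2" "a/2"] assms by simp
  then have "(?f has_integral Beta (a/2) (a/2)) {0<..<1}"
    by (simp add: has_integral_Icc_iff_Ioo)
  then have "((\<lambda>y. \<bar>2 * exp (-(2*y)) / (1 + exp (- (2*y)))^2\<bar> * ?f (g y)) has_integral Beta (a/2) (a/2)) UNIV"
    using assms inj unfolding im[symmetric]
    by (intro has_integral_change_of_variables_nonneg[where f = ?f and g = g])
       (auto simp: g_def power2_eq_square add_nonneg_eq_0_iff intro!: derivative_eq_intros)
  then have "((\<lambda>y. 2 powr (a - 1) * (\<bar>2 * exp (-(2*y)) / (1 + exp (- (2*y)))^2\<bar> * ?f (g y))) has_integral 2 powr (a - 1) * Beta (a/2) (a/2)) UNIV"
    by (rule has_integral_mult_right)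
  then have "((\<lambda>y. cosh y powr - a) has_integral 2 powr (a - 1) * Beta (a/2) (a/2)) UNIV"
  proof (rule has_integral_eq[rotated])
    fix y
    have der: "2 * exp (-(2*y)) / (1 + exp (- (2*y)))^2 = 2 * (g y * (1 - g y))"
    proof -
      have "0 < 1 + exp (- (2 * y))" by (simp add: add_pos_pos)
      then show ?thesis
        unfolding g_def by (simp add: field_simps power2_eq_square)
    qed
    have "?f (g y) = (g y * (1 - g y)) powr (a/2 - 1)"
      by (rule powr_mult[symmetric])
    then have "\<bar>2 * exp (-(2*y)) / (1 + exp (- (2*y)))^2\<bar> * ?f (g y)
        = 2 * ((1 / (2 * cosh y)^2) * (1 / (2 * cosh y)^2) powr (a/2 - 1))"
      unfolding der g2 by simp
    also have "\<dots> = 2 * (1 / (2 * cosh y)^2) powr (a/2)"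
      by (subst powr_mult_base) auto
    also have "\<dots> = 2 * (2 * cosh y) powr - a"
    proof -
      have "1 / (2 * cosh y)^2 = (2 * cosh y) powr -2"
        by (subst powr_minus) (simp add: inverse_eq_divide)
      then show ?thesis by (simp add: powr_powr)
    qed
    also have "\<dots> = 2 powr (1 - a) * cosh y powr - a"
      by (subst powr_mult) (auto simp: powr_diff powr_minus divide_inverse)
    finally show "2 powr (a - 1) * (\<bar>2 * exp (-(2*y)) / (1 + exp (- (2*y)))^2\<bar> * ?f (g y)) = cosh y powr - a"
      by (simp flip: powr_add mult.assoc)
  qed
  then have "integral\<^sup>N lborel (\<lambda>y. ennreal (cosh y powr - a) * indicator UNIV y) =
      ennreal (2 powr (a - 1) * Beta (a/2) (a/2))"
    by (intro nn_integral_has_integral_lebesgue') auto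
  then show ?thesis by simp
qed

section \<open>Asymptotics of the logarithmic Gamma function\<close>

lemma Digamma_bounds:
  assumes "1 < (x::real)"
  shows "ln (x - 1) \<le> Digamma x" "Digamma x \<le> ln x"
proof -
  \<comment> \<open>By the functional equation \<open>ln_Gamma\<close> grows by \<open>ln y\<close>
    from \<open>y\<close> to \<open>y + 1\<close>, so the mean value theorem makes
    \<open>ln y\<close> a value of \<open>Digamma\<close> in between. Monotonicity then moves that
    point to \<open>x\<close>.\<close>
  have gen: "\<exists>z>y. z < y + 1 \<and> ln y = Digamma z" if y: "y > 0" for y :: real
  proof -
    have "\<exists>z::real. y < z \<and> z < y + 1 \<and> ln_Gamma (y + 1) - ln_Gamma y = (y + 1 - y) * Digamma z"
      using y by (intro MVT2) (auto intro!: derivative_eq_intros)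
    moreover have "y \<notin> \<int>\<^sub>\<le>\<^sub>0"
      using y by (auto elim: nonpos_Ints_cases')
    then have "ln_Gamma (y + 1) - ln_Gamma y = ln y"
      using y Gamma_real_pos[of y] by (simp add: ln_Gamma_real_pos Gamma_plus1 ln_mult_pos)
    ultimately show ?thesis by auto
  qed
  from gen[of "x - 1"] assms obtain z where z: "z > x - 1" "z < x" "ln (x - 1) = Digamma z" by auto
  show "ln (x - 1) \<le> Digamma x" using z assms Digamma_real_mono[of z x] by auto
  from gen[of "x"] assms obtain z where z: "z > x" "ln x = Digamma z" by auto
  show "Digamma x \<le> ln x" using z assms Digamma_real_mono[of x z] by auto
qed

text \<open>Stirling's formula to first order, by L'Hospital's rule for
  \<open>(ln_Gamma x - x * ln x) / x\<close>, whose quotient of derivatives is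
  \<open>Digamma x - ln x - 1\<close>. It serves the limit that defines the constant for
  \<open>p = 1\<close>.\<close>

lemma ln_Gamma_over_self:
  "((\<lambda>x::real. ln_Gamma x / x - ln x) \<longlongrightarrow> -1) at_top"
proof -
  have "((\<lambda>x::real. Digamma x - ln x) \<longlongrightarrow> 0) at_top"
  proof (rule tendsto_sandwich)
    show "\<forall>\<^sub>F x::real in at_top. ln (x - 1) - ln x \<le> Digamma x - ln x"
      using eventually_gt_at_top[of 1] by eventually_elim (use Digamma_bounds in auto)
    show "\<forall>\<^sub>F x::real in at_top. Digamma x - ln x \<le> 0"
      using eventually_gt_at_top[of 1] by eventually_elim (use Digamma_bounds in auto)
    show "((\<lambda>x::real. ln (x - 1) - ln x) \<longlongrightarrow> 0) at_top" by real_asymp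
  qed auto
  from tendsto_add[OF this tendsto_const[of "-1"]]
  have "((\<lambda>x::real. (Digamma x - (ln x + 1)) / 1) \<longlongrightarrow> -1) at_top"
    by (simp add: diff_diff_eq)
  then have "((\<lambda>x::real. (ln_Gamma x - x * ln x) / x) \<longlongrightarrow> -1) at_top"
  proof (rule lhospital_at_top_at_top[rotated -1])
    show "\<forall>\<^sub>F x::real in at_top. ((\<lambda>x. ln_Gamma x - x * ln x) has_real_derivative Digamma x - (ln x + 1)) (at x)"
      using eventually_gt_at_top[of 0]
      by eventually_elim (auto intro!: derivative_eq_intros)
  qed (auto intro: filterlim_ident always_eventually)
  then show ?thesis
    by (rule Lim_transform_eventually)
       (use eventually_gt_at_top[of 0] in eventually_elim, auto simp: field_simps)
qed

section \<open>Hoelder's inequality and the constant\<close>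

text \<open>Young's inequality for \<open>u\<close> and \<open>v\<close> divided by their norms,
  integrated. The nonnegative integral on the left makes finiteness of the product integral part of
  the conclusion.\<close>

lemma nn_integral_Holder:
  fixes u v :: "'a \<Rightarrow> real"
  assumes "1 < p" "1 < q" "1 / p + 1 / q = 1"
    and [measurable]: "u \<in> borel_measurable M" "v \<in> borel_measurable M"
    and nonneg: "\<And>x. 0 \<le> u x" "\<And>x. 0 \<le> v x"
    and int: "integrable M (\<lambda>x. u x powr p)" "integrable M (\<lambda>x. v x powr q)"
  shows "(\<integral>\<^sup>+x. ennreal (u x * v x) \<partial>M)
    \<le> ennreal ((\<integral>x. u x powr p \<partial>M) powr (1 / p) * (\<integral>x. v x powr q \<partial>M) powr (1 / q))"
proof -
  define A where "A = (\<integral>x. u x powr p \<partial>M)"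
  define B where "B = (\<integral>x. v x powr q \<partial>M)"
  have "0 \<le> A" "0 \<le> B" by (auto simp: A_def B_def)
  show ?thesis
  \<comment> \<open>A vanishing norm cannot be divided by; in that case the product is zero almost
    everywhere.\<close>
  proof (cases "A = 0 \<or> B = 0")
    case True
    have "AE x in M. u x * v x = 0"
    proof (cases "A = 0")
      case True
      then have "AE x in M. u x powr p = 0"
        using integral_nonneg_eq_0_iff_AE[OF int(1)] by (simp add: A_def)
      then show ?thesis by eventually_elim auto
    next
      case False
      then have "AE x in M. v x powr q = 0"
        using True integral_nonneg_eq_0_iff_AE[OF int(2)] by (simp add: B_def)
      then show ?thesis by eventually_elim auto
    qed
    then have "AE x in M. ennreal (u x * v x) = 0"
      by eventually_elim (simp only: ennreal_0)
    then have "(\<integral>\<^sup>+x. ennreal (u x * v x) \<partial>M) = (\<integral>\<^sup>+x. 0 \<partial>M)"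
      by (rule nn_integral_cong_AE)
    then show ?thesis by simp
  next
    case False
    with \<open>0 \<le> A\<close> \<open>0 \<le> B\<close> have pos: "0 < A" "0 < B" by auto
    define \<alpha> where "\<alpha> = A powr (1 / p)"
    define \<beta> where "\<beta> = B powr (1 / q)"
    have ab: "0 < \<alpha>" "0 < \<beta>" "\<alpha> powr p = A" "\<beta> powr q = B"
      using pos assms(1,2) by (auto simp: \<alpha>_def \<beta>_def powr_powr)
    \<comment> \<open>Young's bound multiplied back by \<open>\<alpha> * \<beta>\<close>. Since
      \<open>1 / p + 1 / q = 1\<close>, its integral is exactly the product of the norms.\<close>
    define w where "w = (\<lambda>x. \<alpha> * \<beta> * (u x powr p / (p * A) + v x powr q / (q * B)))"
    have uv: "u x * v x \<le> w x" for x
    proof -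
      have "(u x / \<alpha>) * (v x / \<beta>) \<le> (u x / \<alpha>) powr p / p + (v x / \<beta>) powr q / q"
        using assms(1-3) nonneg ab by (intro Youngs_inequality) auto
      also have "\<dots> = u x powr p / (p * A) + v x powr q / (q * B)"
        using nonneg ab by (simp add: powr_divide mult.commute)
      finally show ?thesis
        using ab by (simp add: w_def field_simps)
    qed
    have w: "integrable M w" "(\<integral>x. w x \<partial>M) = \<alpha> * \<beta>"
    proof -
      show "integrable M w" unfolding w_def using int by simp
      have "(\<integral>x. w x \<partial>M) = \<alpha> * \<beta> * (A / (p * A) + B / (q * B))"
        unfolding w_def using int by (simp add: A_def B_def)
      also have "\<dots> = \<alpha> * \<beta>"
        using pos assms(1-3) by (simp add: field_simps)
      finally show "(\<integral>x. w x \<partial>M) = \<alpha> * \<beta>" .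
    qed
    have "(\<integral>\<^sup>+x. ennreal (u x * v x) \<partial>M) \<le> (\<integral>\<^sup>+x. ennreal (w x) \<partial>M)"
      using uv by (intro nn_integral_mono ennreal_leI)
    also have "\<dots> = ennreal (\<alpha> * \<beta>)"
      using uv nonneg w by (subst nn_integral_eq_integral) (auto intro!: AE_I2 intro: order_trans[OF mult_nonneg_nonneg])
    finally show ?thesis by (simp add: \<alpha>_def \<beta>_def A_def B_def)
  qed
qed

text \<open>
  This is the norm of \<open>x \<mapsto> exp (- x powr (1/4))\<close> in the dual space \<open>L\<^bsub>1-\<nu>,q\<^esub>\<close>;
  replacing \<open>x powr (1/4)\<close> by \<open>c * x powr (1/4)\<close> scales it by \<open>c powr (- 4 * (1 - \<nu>))\<close>.
\<close>

definition holder_const :: "real \<Rightarrow> real \<Rightarrow> real" where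
  "holder_const \<nu> p =
    (if p = 1 then (4 * (1 - \<nu>) / exp 1) powr (4 * (1 - \<nu>))
     else let q = p / (p - 1) in (4 * Gamma (4 * (1 - \<nu>) * q)) powr (1 / q) * q powr (4 * (\<nu> - 1)))"

lemma holder_const_nonneg: "0 \<le> holder_const \<nu> p"
  by (simp add: holder_const_def Let_def)

text \<open>The left side peaks at \<open>t = s\<close>; after taking logarithms this is
  \<open>ln y \<le> y - 1\<close> at \<open>y = t / s\<close>.\<close>

lemma powr_times_exp_minus_le:
  fixes s t :: real
  assumes "0 < s" "0 < t"
  shows "t powr s * exp (- t) \<le> (s / exp 1) powr s"
proof -
  have "ln (t / s) \<le> t / s - 1"
    using assms by (intro ln_le_minus_one) auto
  then have "s * ln (t / s) \<le> s * (t / s - 1)"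
    using assms by (intro mult_left_mono) auto
  then have "s * ln t - t \<le> s * ln s - s"
    using assms by (simp add: ln_div algebra_simps)
  moreover have "(s / exp 1) powr s = exp (s * ln s - s)"
    using assms by (simp add: powr_def ln_div algebra_simps)
  ultimately show ?thesis
    using assms by (simp add: powr_def mult_exp_exp)
qed

text \<open>Hoelder's inequality for the pairing of \<open>f\<close> with an exponential. The power
  of \<open>c\<close> in the bound does not depend on \<open>p\<close>, and it is this power that is
  later integrated over the plane.\<close>

lemma exp_weighted_bound:
  assumes "1 \<le> p" "\<nu> < 1" "0 < c" and f: "f \<in> weighted_Lp \<nu> p"
  shows "(\<integral>\<^sup>+x. ennreal (exp (- (c * x powr (1/4))) * norm (f x)) * indicator {0<..} x \<partial>lebesgue)
    \<le> ennreal (holder_const \<nu> p * c powr (- (4 * (1 - \<nu>))) * weighted_Lp_norm \<nu> p f)"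
proof -
  \<comment> \<open>Membership in \<open>weighted_Lp\<close> restricts \<open>f\<close> on the
    half-line only, so measurability is available after multiplication by the indicator.\<close>
  define I where "I = indicat_real {0::real<..}"
  have I01: "I x = 1 \<or> I x = 0" "0 \<le> I x" for x by (auto simp: I_def indicator_def)
  have [measurable]: "I \<in> borel_measurable lebesgue"
    unfolding I_def by (intro borel_measurable_indicator) auto
  have fm: "(\<lambda>x. I x *\<^sub>R f x) \<in> borel_measurable lebesgue"
    using f by (simp add: weighted_Lp_def set_borel_measurable_def I_def)
  have [measurable]: "(\<lambda>x. x powr r) \<in> borel_measurable lebesgue" for r :: real
    by (intro measurable_completion) auto
  have powm: "(\<lambda>x. exp (- (c * x powr (1/4)))) \<in> borel_measurable lebesgue"
    by measurable
  have fint: "integrable lebesgue (\<lambda>x. I x * (norm (f x) powr p * x powr (\<nu> * p - 1)))"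
    using f by (simp add: weighted_Lp_def set_integrable_def I_def)
  have normf: "weighted_Lp_norm \<nu> p f = (\<integral>x. I x * (norm (f x) powr p * x powr (\<nu> * p - 1)) \<partial>lebesgue) powr (1 / p)"
    by (simp add: weighted_Lp_norm_def set_lebesgue_integral_def I_def)
  show ?thesis
  proof (cases "p = 1")
    case True
    define K where "K = holder_const \<nu> p * c powr (- (4 * (1 - \<nu>)))"
    have Knn: "0 \<le> K" by (simp add: K_def holder_const_nonneg)
    \<comment> \<open>For \<open>p = 1\<close> Hoelder's inequality is a supremum bound for
      \<open>exp (- (c * x powr (1/4))) * x powr (1 - \<nu>)\<close>. It comes from
      \<open>powr_times_exp_minus_le\<close> at \<open>t = c * x powr (1/4)\<close> and
      \<open>s = 4 * (1 - \<nu>)\<close>.\<close>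
    have le: "exp (- (c * x powr (1/4))) * norm (f x) * I x \<le> K * (I x * (norm (f x) * x powr (\<nu> - 1)))" for x
    proof (cases "x > 0")
      case x: True
      have "(c * x powr (1/4)) powr (4 * (1 - \<nu>)) * c powr (- (4 * (1 - \<nu>))) = x powr (1 - \<nu>)"
      proof -
        have "c powr k * (x powr (1/4)) powr k * c powr (- k) = x powr (k / 4)" for k
          using x assms by (simp add: powr_powr powr_minus)
        from this[of "4 * (1 - \<nu>)"] show ?thesis
          using x assms by (simp add: powr_mult diff_divide_distrib)
      qed
      then have "exp (- (c * x powr (1/4))) * x powr (1 - \<nu>)
          = ((c * x powr (1/4)) powr (4 * (1 - \<nu>)) * exp (- (c * x powr (1/4)))) * c powr (- (4 * (1 - \<nu>)))"
        by simp
      also have "\<dots> \<le> K"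
      proof -
        have "(c * x powr (1/4)) powr (4 * (1 - \<nu>)) * exp (- (c * x powr (1/4))) \<le> holder_const \<nu> p"
          using powr_times_exp_minus_le[of "4 * (1 - \<nu>)" "c * x powr (1/4)"] x assms True
          by (simp add: holder_const_def)
        then show ?thesis
          unfolding K_def by (rule mult_right_mono) auto
      qed
      finally have "exp (- (c * x powr (1/4))) * x powr (1 - \<nu>) * (norm (f x) * x powr (\<nu> - 1))
          \<le> K * (norm (f x) * x powr (\<nu> - 1))"
        by (rule mult_right_mono) auto
      moreover have "x powr (1 - \<nu>) * x powr (\<nu> - 1) = 1"
        using x by (simp flip: powr_add)
      then have "exp (- (c * x powr (1/4))) * x powr (1 - \<nu>) * (norm (f x) * x powr (\<nu> - 1))
         = exp (- (c * x powr (1/4))) * norm (f x)"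
        by (simp add: algebra_simps)
      ultimately show ?thesis using x by (simp add: I_def)
    qed (auto simp: I_def)
    have "(\<integral>\<^sup>+x. ennreal (exp (- (c * x powr (1/4))) * norm (f x)) * indicator {0<..} x \<partial>lebesgue)
       \<le> (\<integral>\<^sup>+x. ennreal (K * (I x * (norm (f x) * x powr (\<nu> - 1)))) \<partial>lebesgue)"
    proof (intro nn_integral_mono)
      fix x show "ennreal (exp (- (c * x powr (1/4))) * norm (f x)) * indicator {0<..} x
          \<le> ennreal (K * (I x * (norm (f x) * x powr (\<nu> - 1))))"
        using ennreal_leI[OF le[of x]] by (auto simp: I_def indicator_def split: if_splits)
    qed
    also have "\<dots> = ennreal (\<integral>x. K * (I x * (norm (f x) * x powr (\<nu> - 1))) \<partial>lebesgue)"
      using fint True Knn I01 by (intro nn_integral_eq_integral) auto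
    also have "(\<integral>x. K * (I x * (norm (f x) * x powr (\<nu> - 1))) \<partial>lebesgue) = K * weighted_Lp_norm \<nu> p f"
    proof -
      have "0 \<le> (\<integral>x. I x * (norm (f x) * x powr (\<nu> - 1)) \<partial>lebesgue)"
        using I01 by (intro integral_nonneg_AE) auto
      then show ?thesis unfolding normf using True by simp
    qed
    finally show ?thesis by (simp add: K_def)
  next
    case False
    define q where "q = p / (p - 1)"
    have pq: "1 < p" "1 < q" "1 / p + 1 / q = 1"
      using assms False by (auto simp: q_def field_simps)
    define a where "a = (1 - \<nu>) * q"
    have a: "0 < a" "(1 / p - \<nu>) * q = a - 1"
      using pq assms by (auto simp: a_def field_simps)
    \<comment> \<open>The powers of \<open>x\<close> are split so that \<open>u x powr p\<close>
      carries the weight \<open>x powr (\<nu> * p - 1)\<close>; then \<open>v x powr q\<close>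
      carries \<open>x powr (a - 1)\<close>, as in \<open>nn_integral_exp_root4\<close>.\<close>
    define u where "u = (\<lambda>x. norm (I x *\<^sub>R f x) * x powr (\<nu> - 1 / p))"
    define v where "v = (\<lambda>x. exp (- (c * x powr (1/4))) * x powr (1 / p - \<nu>) * I x)"
    have um: "u \<in> borel_measurable lebesgue"
      unfolding u_def using fm by measurable
    have vm: "v \<in> borel_measurable lebesgue"
      unfolding v_def using powm by measurable
    have up: "u x powr p = I x * (norm (f x) powr p * x powr (\<nu> * p - 1))" for x
    proof (cases "x > 0")
      case True
      then show ?thesis using pq
        by (simp add: u_def I_def powr_mult powr_powr) (simp add: algebra_simps)
    qed (auto simp: u_def I_def)
    have vq: "v x powr q = (exp (- (q * c * x powr (1/4))) * x powr (a - 1)) * I x" for x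
    proof (cases "x > 0")
      case True
      then show ?thesis using pq
        by (simp add: v_def I_def powr_mult powr_powr exp_powr_real mult_ac flip: a(2))
    qed (auto simp: v_def I_def)
    have "(\<integral>\<^sup>+x. ennreal (v x powr q) \<partial>lebesgue) = ennreal (4 * Gamma (4 * a) * (q * c) powr (- (4 * a)))"
    proof -
      have "(\<integral>\<^sup>+x. ennreal (v x powr q) \<partial>lebesgue)
        = (\<integral>\<^sup>+x. ennreal (exp (- (q * c * x powr (1/4))) * x powr (a - 1)) * indicator {0<..} x \<partial>lborel)"
        unfolding nn_integral_completion vq by (intro nn_integral_cong) (auto simp: I_def indicator_def)
      then show ?thesis
        using nn_integral_exp_root4[OF a(1), of "q * c"] assms pq by simp
    qed
    then have "has_bochner_integral lebesgue (\<lambda>x. v x powr q) (4 * Gamma (4 * a) * (q * c) powr (- (4 * a)))"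
      using a vm by (intro has_bochner_integral_nn_integral) (auto simp: less_imp_le)
    then have v: "integrable lebesgue (\<lambda>x. v x powr q)"
      "(\<integral>x. v x powr q \<partial>lebesgue) = 4 * Gamma (4 * a) * (q * c) powr (- (4 * a))"
      by (auto simp: has_bochner_integral_iff)
    have uv: "u x * v x = exp (- (c * x powr (1/4))) * norm (f x) * I x" for x
    proof (cases "x > 0")
      case True
      have "x powr (\<nu> - 1 / p) * x powr (1 / p - \<nu>) = 1" using True by (simp flip: powr_add)
      then show ?thesis using True by (simp add: u_def v_def I_def algebra_simps)
    qed (auto simp: u_def v_def I_def)
    have "(\<integral>\<^sup>+x. ennreal (exp (- (c * x powr (1/4))) * norm (f x)) * indicator {0<..} x \<partial>lebesgue)
      = (\<integral>\<^sup>+x. ennreal (u x * v x) \<partial>lebesgue)"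
      unfolding uv by (intro nn_integral_cong) (auto simp: I_def indicator_def)
    also have "\<dots> \<le> ennreal ((\<integral>x. u x powr p \<partial>lebesgue) powr (1 / p) * (\<integral>x. v x powr q \<partial>lebesgue) powr (1 / q))"
      using pq um vm v(1) fint I01
      by (intro nn_integral_Holder) (auto simp: up, auto simp: u_def v_def)
    also have "(\<integral>x. u x powr p \<partial>lebesgue) powr (1 / p) = weighted_Lp_norm \<nu> p f"
      unfolding up normf ..
    also have "(\<integral>x. v x powr q \<partial>lebesgue) powr (1 / q) = holder_const \<nu> p * c powr (- (4 * (1 - \<nu>)))"
    proof -
      have "(4 * Gamma (4 * a) * (q * c) powr (- (4 * a))) powr (1 / q)
         = (4 * Gamma (4 * a)) powr (1 / q) * (q * c) powr (- (4 * (1 - \<nu>)))"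
        using a pq assms by (simp add: powr_mult powr_powr a_def)
      also have "\<dots> = (4 * Gamma (4 * (1 - \<nu>) * q)) powr (1 / q) * q powr (4 * (\<nu> - 1)) * c powr (- (4 * (1 - \<nu>)))"
      proof -
        have "4 * a = 4 * (1 - \<nu>) * q" by (simp add: a_def)
        then show ?thesis using pq assms by (simp add: powr_mult)
      qed
      finally show ?thesis
        unfolding v holder_const_def using False by (simp add: Let_def q_def)
    qed
    finally show ?thesis by (simp add: mult_ac)
  qed
qed

text \<open>For \<open>1 < p\<close> this is a regrouping: \<open>4 powr (1 / q)\<close> moves under
  the root of the Gamma value. For \<open>p = 1\<close> the limit of the constants has to match the
  supremum bound: with \<open>s = 4 * (1 - \<nu>)\<close>,
  \<open>q powr - s * Gamma (s * q) powr (1 / q)\<close> tends to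
  \<open>(s / exp 1) powr s\<close>.\<close>

lemma index_const_eq:
  assumes "1 \<le> p" "\<nu> < 1"
  shows "index_const \<nu> p = 4 powr (\<nu> - 3) * holder_const \<nu> p *
    Beta (1 - \<nu>) (1 - \<nu>) * Beta (2 * (1 - \<nu>)) (2 * (1 - \<nu>))"
proof (cases "p = 1")
  case True
  define s where "s = 4 * (1 - \<nu>)"
  have s: "0 < s" "4 * (\<nu> - 1) = - s" using assms by (auto simp: s_def)
  let ?B = "Beta (1 - \<nu>) (1 - \<nu>) * Beta (2 * (1 - \<nu>)) (2 * (1 - \<nu>))"
  have "((\<lambda>q. ln_Gamma (s * q) / (s * q) - ln (s * q)) \<longlongrightarrow> - 1) at_top"
    by (rule filterlim_compose[OF ln_Gamma_over_self])
       (use s in \<open>auto intro!: filterlim_tendsto_pos_mult_at_top filterlim_ident\<close>)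
  \<comment> \<open>For positive \<open>q\<close> the exponent is
    \<open>ln (Gamma (s * q)) / q - s * ln q\<close>, rearranged so that the Stirling limit
    applies.\<close>
  then have lim1: "((\<lambda>q. exp (s * (ln_Gamma (s * q) / (s * q) - ln (s * q)) + s * ln s)) \<longlongrightarrow> exp (s * (-1) + s * ln s)) at_top"
    by (intro tendsto_intros)
  have lim2: "((\<lambda>q::real. 4 powr (\<nu> - 3 + 1 / q)) \<longlongrightarrow> 4 powr (\<nu> - 3)) at_top"
    by (real_asymp simp: powr_def)
  have "((\<lambda>q. 4 powr (\<nu> - 3 + 1 / q) * exp (s * (ln_Gamma (s * q) / (s * q) - ln (s * q)) + s * ln s) * ?B)
     \<longlongrightarrow> 4 powr (\<nu> - 3) * exp (s * (-1) + s * ln s) * ?B) at_top"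
    by (rule tendsto_mult[OF tendsto_mult[OF lim2 lim1] tendsto_const])
  moreover have "\<forall>\<^sub>F q in at_top. 4 powr (\<nu> - 3 + 1 / q) * exp (s * (ln_Gamma (s * q) / (s * q) - ln (s * q)) + s * ln s) * ?B
      = index_const_q \<nu> q"
    using eventually_gt_at_top[of 0]
  proof eventually_elim
    case (elim q)
    have "exp (s * (ln_Gamma (s * q) / (s * q) - ln (s * q)) + s * ln s) = exp (- s * ln q + ln (Gamma (s * q)) / q)"
      using s elim by (simp add: ln_Gamma_real_pos ln_mult_pos field_simps)
    also have "\<dots> = q powr (- s) * Gamma (s * q) powr (1 / q)"
    proof -
      have "0 < Gamma (s * q)" using s elim by (intro Gamma_real_pos) auto
      then show ?thesis using elim by (simp add: powr_def mult_exp_exp)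
    qed
    finally show ?case
      unfolding index_const_q_def s s_def[symmetric] by (simp add: mult_ac)
  qed
  ultimately have "(index_const_q \<nu> \<longlongrightarrow> 4 powr (\<nu> - 3) * exp (s * (-1) + s * ln s) * ?B) at_top"
    by (rule Lim_transform_eventually)
  then have "Lim at_top (index_const_q \<nu>) = 4 powr (\<nu> - 3) * exp (s * (-1) + s * ln s) * ?B"
    by (intro tendsto_Lim) auto
  moreover have "exp (s * (-1) + s * ln s) = holder_const \<nu> p"
    using True s unfolding holder_const_def s_def[symmetric]
    by (simp add: powr_def ln_div right_diff_distrib)
  ultimately show ?thesis
    using True by (simp add: index_const_def)
next
  case False
  define q where "q = p / (p - 1)"
  have "0 < q" using False assms by (auto simp: q_def)
  then have "0 < Gamma (4 * (1 - \<nu>) * q)" using assms by (intro Gamma_real_pos) auto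
  then show ?thesis
    using False by (simp add: index_const_def index_const_q_def holder_const_def Let_def powr_mult powr_add flip: q_def)
qed

section \<open>The product formula for the kernel\<close>

lemma of_real_cosh: "of_real (cosh x) = cosh (of_real x :: complex)"
  by (simp add: cosh_field_def flip: exp_of_real)

lemma borel_measurable_cosh [measurable]: "(cosh :: real \<Rightarrow> real) \<in> borel_measurable borel"
  by (intro borel_measurable_continuous_onI continuous_intros)

text \<open>From \<open>t \<le> exp t\<close> at \<open>t = c * cosh y\<close> the integrand is at
  most \<open>1 / (c * cosh y)\<close>, which is integrable by the case \<open>a = 1\<close> of the
  Beta formula.\<close>

lemma integrable_exp_cosh:
  assumes "0 < (c::real)"
  shows "integrable lborel (\<lambda>y. exp (- (c * cosh y)))"
proof (rule Bochner_Integration.integrable_bound)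
  have "integrable lborel (\<lambda>y::real. cosh y powr - 1)"
    using nn_integral_cosh_powr[of 1] by (intro integrableI_nn_integral_finite) auto
  then show "integrable lborel (\<lambda>y::real. inverse c * cosh y powr - 1)"
    by (rule integrable_mult_right)
  show "AE y in lborel. norm (exp (- (c * cosh y))) \<le> norm (inverse c * cosh y powr - 1)"
  proof (intro AE_I2)
    fix y :: real
    have "c * cosh y \<le> exp (c * cosh y)" using exp_ge_add_one_self[of "c * cosh y"] by linarith
    then show "norm (exp (- (c * cosh y))) \<le> norm (inverse c * cosh y powr - 1)"
      using assms by (simp add: exp_minus powr_minus abs_mult less_imp_le flip: inverse_mult_distrib)
  qed
qed auto

lemma integrable_exp_cosh_oscillating:
  assumes "0 < Re X"
  shows "integrable lborel (\<lambda>y::real. exp (- X * cosh (of_real y)) * exp (\<i> * of_real t * of_real y))"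
proof (rule Bochner_Integration.integrable_bound[OF integrable_exp_cosh[OF assms]])
  show "AE y in lborel. norm (exp (- X * cosh (complex_of_real y)) * exp (\<i> * of_real t * of_real y))
      \<le> norm (exp (- (Re X * cosh y)))"
    by (auto simp: norm_mult simp flip: of_real_cosh)
qed (auto intro!: borel_measurable_continuous_onI continuous_intros)

lemma lborel_integral_uminus:
  fixes f :: "real \<Rightarrow> complex"
  shows "(\<integral>y. f (- y) \<partial>lborel) = (\<integral>y. f y \<partial>lborel)"
  using lborel_integral_real_affine[of "-1" f 0] by simp

text \<open>The \<open>cosh\<close> factor in the definition is the even part of the exponential,
  whose odd part integrates to zero. In exponential form the oscillating factors of two such
  integrals can be merged.\<close>

lemma bessel_K_eq_integral:
  assumes "0 < Re X"
  shows "bessel_K (\<i> * of_real t) X =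
    (\<integral>y. exp (- X * cosh (of_real y)) * exp (\<i> * of_real t * of_real y) \<partial>lborel) / 2"
proof -
  define h where "h = (\<lambda>y::real. exp (- X * cosh (of_real y)) * exp (\<i> * of_real t * of_real y))"
  define k where "k = (\<lambda>y::real. exp (- X * cosh (of_real y)) * cosh (\<i> * of_real t * of_real y))"
  define \<phi> where "\<phi> = (\<lambda>y::real. indicator {0<..} y *\<^sub>R k y)"
  have h: "integrable lborel h"
    unfolding h_def by (rule integrable_exp_cosh_oscillating[OF assms])
  have h': "integrable lborel (\<lambda>y. h (- y))"
    using lborel_integrable_real_affine[OF h, of "-1" 0] by simp
  have kh: "k y = (h y + h (- y)) / 2" for y
    unfolding k_def h_def cosh_field_def[of "\<i> * of_real t * of_real y"] by (simp add: algebra_simps)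
  have k: "integrable lborel k"
    unfolding kh using h h' by simp
  have \<phi>: "integrable lborel \<phi>"
    unfolding \<phi>_def using k by (intro integrable_mult_indicator) auto
  have \<phi>': "integrable lborel (\<lambda>y. \<phi> (- y))"
    using lborel_integrable_real_affine[OF \<phi>, of "-1" 0] by simp
  have "(\<integral>y. h y \<partial>lborel) = (\<integral>y. k y \<partial>lborel)"
    unfolding kh using h h' by (simp add: lborel_integral_uminus)
  also have "\<dots> = (\<integral>y. \<phi> y + \<phi> (- y) \<partial>lborel)"
  proof (rule integral_cong_AE)
    \<comment> \<open>At \<open>0\<close> both indicators vanish, so equality holds off that point
      only.\<close>
    show "AE y in lborel. k y = \<phi> y + \<phi> (- y)"
      using AE_lborel_singleton[of 0]
    proof eventually_elim
      case (elim y)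
      have "k (- y) = k y" by (simp add: kh)
      then show ?case using elim by (auto simp: \<phi>_def indicator_def)
    qed
  qed (use k \<phi> \<phi>' in auto)
  also have "\<dots> = 2 * (\<integral>y. \<phi> y \<partial>lborel)"
    using \<phi> \<phi>' by (simp add: lborel_integral_uminus)
  finally show ?thesis
    by (simp add: bessel_K_def set_lebesgue_integral_def h_def \<phi>_def k_def)
qed

lemma lborel_integral_diff:
  fixes f :: "real \<Rightarrow> 'a::{banach, second_countable_topology}"
  shows "(\<integral>u. f (u - a) \<partial>lborel) = (\<integral>u. f u \<partial>lborel)"
  using lborel_integral_real_affine[of 1 f "- a"] by simp

text \<open>Set \<open>u = a + b\<close>, then \<open>a = u / 2 + d\<close> for fixed
  \<open>u\<close>. Both changes are translations of one variable, so Fubini and translation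
  invariance suffice.\<close>

lemma integral_mult_eq_convolution:
  fixes f g :: "real \<Rightarrow> complex"
  assumes f: "integrable lborel f" and g: "integrable lborel g"
  shows "(\<integral>a. f a \<partial>lborel) * (\<integral>b. g b \<partial>lborel)
    = (\<integral>u. (\<integral>d. f (u / 2 + d) * g (u / 2 - d) \<partial>lborel) \<partial>lborel)"
proof -
  have [measurable]: "f \<in> borel_measurable borel" "g \<in> borel_measurable borel"
    using f g by auto
  have ishift: "integrable lborel (\<lambda>u. g (u - a))" for a
    using lborel_integrable_real_affine[OF g, of 1 "-a"] by simp
  have prod: "integrable (lborel \<Otimes>\<^sub>M lborel) (\<lambda>(a, u). f a * g (u - a))"
  proof (rule lborel_pair.Fubini_integrable, goal_cases)
    case 1 show ?case by measurable
  next
    case 2 show ?case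
      using f by (simp add: norm_mult lborel_integral_diff[of "\<lambda>u. norm (g u)"])
  next
    case 3 show ?case
      using ishift by auto
  qed

  have "(\<integral>a. f a \<partial>lborel) * (\<integral>b. g b \<partial>lborel) = (\<integral>a. (\<integral>u. f a * g (u - a) \<partial>lborel) \<partial>lborel)"
    by (simp add: lborel_integral_diff[of g])
  also have "\<dots> = (\<integral>u. (\<integral>a. f a * g (u - a) \<partial>lborel) \<partial>lborel)"
    using lborel_pair.Fubini_integral[OF prod] by simp
  also have "\<dots> = (\<integral>u. (\<integral>d. f (u / 2 + d) * g (u / 2 - d) \<partial>lborel) \<partial>lborel)"
  proof (rule Bochner_Integration.integral_cong[OF refl])
    fix u :: real
    show "(\<integral>a. f a * g (u - a) \<partial>lborel) = (\<integral>d. f (u / 2 + d) * g (u / 2 - d) \<partial>lborel)"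
      using lborel_integral_real_affine[of 1 "\<lambda>a. f a * g (u - a)" "u / 2"] by (simp add: diff_diff_eq[symmetric])
  qed
  finally show ?thesis .
qed

section \<open>Shift of the line of integration\<close>

lemma Re_cosh: "Re (cosh z) = cosh (Re z) * cos (Im z)"
  by (simp add: cosh_field_def Re_exp algebra_simps)

text \<open>
  Shifting the line of integration: the integrand has an entire primitive \<open>G\<close>, and the vertical
  sides of the rectangle vanish at infinity.
\<close>

lemma LBINT_exp_cosh_shift:
  assumes "0 < w" "\<bar>\<theta>\<bar> < pi / 2"
  shows "(\<integral>d. exp (- of_real w * cosh (of_real d + \<i> * of_real \<theta>)) \<partial>lborel)
    = (\<integral>d. exp (- of_real w * cosh (of_real d)) \<partial>lborel)"
proof -
  define F :: "complex \<Rightarrow> complex" where "F = (\<lambda>z. exp (- of_real w * cosh z))"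
  have "F holomorphic_on UNIV"
  proof (rule holomorphic_onI)
    fix z
    have "(F has_field_derivative exp (- of_real w * cosh z) * (- of_real w * sinh z)) (at z)"
      unfolding F_def by (auto intro!: derivative_eq_intros)
    then show "F field_differentiable at z within UNIV"
      by (auto simp: field_differentiable_def)
  qed
  then obtain G where G: "\<And>z. (G has_field_derivative F z) (at z)"
    using holomorphic_convex_primitive'[of UNIV F] by auto
  have normF: "norm (F z) = exp (- (w * (cosh (Re z) * cos (Im z))))" for z
    by (simp add: F_def Re_cosh)
  have cont: "continuous_on A F" for A
    unfolding F_def by (intro continuous_intros)
  \<comment> \<open>On a horizontal line inside the strip \<open>cos s\<close> is positive and the
    integrand decays, so its integral is the limit of the increments of \<open>G\<close> between
    abscissas \<open>- n\<close> and \<open>n\<close>.\<close>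
  have lim: "(\<lambda>n. G (of_real (real n) + \<i> * of_real s) - G (of_real (- real n) + \<i> * of_real s))
      \<longlonglongrightarrow> (\<integral>d. F (of_real d + \<i> * of_real s) \<partial>lborel)" if s: "\<bar>s\<bar> < pi / 2" for s
  proof -
    have c: "0 < cos s" using s by (intro cos_gt_zero_pi) auto
    let ?f = "\<lambda>d::real. F (of_real d + \<i> * of_real s)"
    have [measurable]: "?f \<in> borel_measurable borel"
      unfolding F_def by (intro borel_measurable_continuous_onI continuous_intros)
    have int: "integrable lborel ?f"
    proof (rule Bochner_Integration.integrable_bound)
      show "integrable lborel (\<lambda>d. exp (- (w * cos s * cosh d)))"
        using c assms by (intro integrable_exp_cosh) auto
      show "AE d in lborel. norm (?f d) \<le> norm (exp (- (w * cos s * cosh d)))"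
        by (simp add: normF mult_ac)
    qed simp
    have "(\<lambda>n. \<integral>d. indicator {- real n..real n} d *\<^sub>R ?f d \<partial>lborel) \<longlonglongrightarrow> (\<integral>d. ?f d \<partial>lborel)"
    proof (rule integral_dominated_convergence[where w = "\<lambda>d. norm (?f d)"])
      show "AE d in lborel. (\<lambda>n. indicator {- real n..real n} d *\<^sub>R ?f d) \<longlonglongrightarrow> ?f d"
      proof (intro AE_I2 tendsto_eventually)
        fix d :: real
        show "\<forall>\<^sub>F n in sequentially. indicator {- real n..real n} d *\<^sub>R ?f d = ?f d"
          using eventually_ge_at_top[of "nat \<lceil>\<bar>d\<bar>\<rceil>"]
        proof eventually_elim
          case (elim n)
          then have "\<bar>d\<bar> \<le> real n" using real_nat_ceiling_ge[of "\<bar>d\<bar>"] by linarith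
          then show ?case by (simp add: indicator_def abs_le_iff)
        qed
      qed
      show "AE d in lborel. norm (indicator {- real n..real n} d *\<^sub>R ?f d) \<le> norm (?f d)" for n
        by (auto simp: indicator_def)
    qed (use int in auto)
    moreover have "(\<integral>d. indicator {- real n..real n} d *\<^sub>R ?f d \<partial>lborel)
        = G (of_real (real n) + \<i> * of_real s) - G (of_real (- real n) + \<i> * of_real s)" for n
    proof (rule integral_FTC_atLeastAtMost)
      show "((\<lambda>d. G (of_real d + \<i> * of_real s)) has_vector_derivative ?f d) (at d within {- real n..real n})" for d
      proof -
        have "((\<lambda>d. of_real d + \<i> * of_real s :: complex) has_vector_derivative 1) (at d)"
          by (auto intro!: derivative_eq_intros simp: has_vector_derivative_of_real)
        from field_vector_diff_chain_at[OF this G] show ?thesis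
          by (simp add: o_def has_vector_derivative_at_within)
      qed
      show "continuous_on {- real n..real n} ?f"
        by (intro continuous_on_compose2[OF cont[of UNIV]] continuous_intros) auto
    qed auto
    ultimately show ?thesis by simp
  qed
  have c: "0 < cos \<theta>" using assms by (intro cos_gt_zero_pi) auto
  \<comment> \<open>On a vertical side the increment of \<open>G\<close> is at most the length times
    a bound for \<open>F\<close>; the cosine along the side is at least
    \<open>cos \<theta>\<close>.\<close>
  have seg: "norm (G (of_real x + \<i> * of_real \<theta>) - G (of_real x)) \<le> exp (- (w * (cosh x * cos \<theta>))) * \<bar>\<theta>\<bar>" for x :: real
  proof -
    let ?S = "closed_segment (of_real x) (of_real x + \<i> * of_real \<theta>)"
    have "norm (G (of_real x + \<i> * of_real \<theta>) - G (of_real x))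
        \<le> exp (- (w * (cosh x * cos \<theta>))) * norm (of_real x + \<i> * of_real \<theta> - complex_of_real x)"
    proof (rule field_differentiable_bound[of ?S G F])
      show "(G has_field_derivative F z) (at z within ?S)" for z
        using G by (rule has_field_derivative_at_within)
      fix z assume "z \<in> ?S"
      then obtain t where t: "0 \<le> t" "t \<le> 1" "z = of_real x + of_real t * (\<i> * of_real \<theta>)"
        by (auto simp: closed_segment_def algebra_simps scaleR_conv_of_real)
      then have z: "Re z = x" "Im z = t * \<theta>" by auto
      have "cos \<bar>\<theta>\<bar> \<le> cos \<bar>t * \<theta>\<bar>"
        using t assms by (intro cos_monotone_0_pi_le) (auto simp: abs_mult mult_left_le_one_le)
      then show "norm (F z) \<le> exp (- (w * (cosh x * cos \<theta>)))"
        using assms by (simp add: normF z)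
    qed auto
    then show ?thesis by (simp add: norm_mult)
  qed
  have "(\<lambda>n. (G (of_real (real n) + \<i> * of_real \<theta>) - G (of_real (- real n) + \<i> * of_real \<theta>))
      - (G (of_real (real n) + \<i> * of_real 0) - G (of_real (- real n) + \<i> * of_real 0))) \<longlonglongrightarrow> 0"
  proof (rule Lim_null_comparison)
    show "\<forall>\<^sub>F n in sequentially. norm ((G (of_real (real n) + \<i> * of_real \<theta>) - G (of_real (- real n) + \<i> * of_real \<theta>))
      - (G (of_real (real n) + \<i> * of_real 0) - G (of_real (- real n) + \<i> * of_real 0)))
      \<le> 2 * (exp (- ((w * cos \<theta>) * cosh (real n))) * \<bar>\<theta>\<bar>)"
    proof (intro always_eventually allI)
      fix n
      have "norm ((a - b) - (a' - b')) \<le> 2 * e" if "norm (a - a') \<le> e" "norm (b - b') \<le> e" for a b a' b' :: complex and e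
      proof -
        have "norm ((a - b) - (a' - b')) = norm ((a - a') - (b - b'))" by (simp add: algebra_simps)
        then show ?thesis using that norm_triangle_ineq4[of "a - a'" "b - b'"] by linarith
      qed
      from this[OF seg[of "real n"], of "G (of_real (- real n) + \<i> * of_real \<theta>)" "G (of_real (- real n))"] seg[of "- real n"]
      show "norm ((G (of_real (real n) + \<i> * of_real \<theta>) - G (of_real (- real n) + \<i> * of_real \<theta>))
      - (G (of_real (real n) + \<i> * of_real 0) - G (of_real (- real n) + \<i> * of_real 0)))
      \<le> 2 * (exp (- ((w * cos \<theta>) * cosh (real n))) * \<bar>\<theta>\<bar>)"
        by (simp add: mult_ac)
    qed
    have "filterlim (\<lambda>n. (w * cos \<theta>) * cosh (real n)) at_top sequentially"
      using assms c
      by (intro filterlim_tendsto_pos_mult_at_top[OF tendsto_const]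
            filterlim_compose[OF cosh_real_at_top filterlim_real_sequentially]) auto
    then have "(\<lambda>n. exp (- ((w * cos \<theta>) * cosh (real n)))) \<longlonglongrightarrow> 0"
      by (intro filterlim_compose[OF exp_at_bot]) (simp add: filterlim_uminus_at_bot)
    then have "(\<lambda>n. 2 * (exp (- ((w * cos \<theta>) * cosh (real n))) * \<bar>\<theta>\<bar>)) \<longlonglongrightarrow> 2 * (0 * \<bar>\<theta>\<bar>)"
      by (intro tendsto_intros)
    then show "(\<lambda>n. 2 * (exp (- ((w * cos \<theta>) * cosh (real n))) * \<bar>\<theta>\<bar>)) \<longlonglongrightarrow> 0"
      by simp
  qed
  moreover have "(\<lambda>n. (G (of_real (real n) + \<i> * of_real \<theta>) - G (of_real (- real n) + \<i> * of_real \<theta>))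
      - (G (of_real (real n) + \<i> * of_real 0) - G (of_real (- real n) + \<i> * of_real 0)))
      \<longlonglongrightarrow> (\<integral>d. F (of_real d + \<i> * of_real \<theta>) \<partial>lborel) - (\<integral>d. F (of_real d + \<i> * of_real 0) \<partial>lborel)"
    using assms by (intro tendsto_diff lim) auto
  ultimately have "(\<integral>d. F (of_real d + \<i> * of_real \<theta>) \<partial>lborel) - (\<integral>d. F (of_real d + \<i> * of_real 0) \<partial>lborel) = 0"
    by (rule LIMSEQ_unique[rotated])
  then show ?thesis by (simp add: F_def)
qed

text \<open>
  With \<open>R cos \<theta> = cosh s\<close> and \<open>R sin \<theta> = sinh s\<close>, the exponent on the left is
  \<open>- w R cosh (d + \<i> \<theta>)\<close>.
\<close>

lemma LBINT_exp_cosh_sinh: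
  assumes "0 < w"
  shows "(\<integral>d. exp (- of_real w * (of_real (cosh s * cosh d) + \<i> * of_real (sinh s * sinh d))) \<partial>lborel)
    = (\<integral>d. exp (- of_real (w * sqrt (cosh (2 * s)) * cosh d)) \<partial>lborel :: complex)"
proof -
  \<comment> \<open>\<open>R\<close> is the modulus and \<open>\<theta>\<close> the argument of
    \<open>cosh s + \<i> * sinh s\<close>; the squared modulus is
    \<open>(cosh s)^2 + (sinh s)^2 = cosh (2 * s)\<close>.\<close>
  define R where "R = sqrt (cosh (2 * s))"
  define \<theta> where "\<theta> = arctan (sinh s / cosh s)"
  have R: "0 < R" by (simp add: R_def)
  have "1 + (sinh s / cosh s)\<^sup>2 = cosh (2 * s) / (cosh s)\<^sup>2"
    unfolding cosh_double by (simp add: power_divide field_simps)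
  then have "sqrt (1 + (sinh s / cosh s)\<^sup>2) = R / cosh s"
    by (simp add: real_sqrt_divide R_def)
  then have polar: "R * cos \<theta> = cosh s" "R * sin \<theta> = sinh s"
    using R unfolding \<theta>_def cos_arctan sin_arctan by simp_all
  have "of_real w * (of_real (cosh s * cosh d) + \<i> * of_real (sinh s * sinh d))
      = of_real (w * R) * cosh (of_real d + \<i> * of_real \<theta>)" for d
  proof -
    have "cosh (of_real d + \<i> * of_real \<theta>) = of_real (cosh d * cos \<theta>) + \<i> * of_real (sinh d * sin \<theta>)"
      by (auto simp: complex_eq_iff Re_cosh) (simp add: cosh_field_def sinh_field_def Im_exp algebra_simps)
    then show ?thesis
      by (simp add: algebra_simps flip: polar)
  qed
  moreover have "\<bar>\<theta>\<bar> < pi / 2"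
    unfolding \<theta>_def using arctan_bounded[of "sinh s / cosh s"] by linarith
  ultimately show ?thesis
    using LBINT_exp_cosh_shift[of "w * R" \<theta>] assms R
    by (simp add: R_def of_real_cosh mult.assoc)
qed

text \<open>The sum of squares factors as \<open>(ker + \<i> * kei) * (ker - \<i> * kei)\<close>,
  and the phases in the two Kelvin equations are reciprocal, which leaves a product of two Bessel
  functions. The merged oscillation depends on \<open>u\<close> alone, and
  \<open>LBINT_exp_cosh_sinh\<close> at \<open>s = u / 2\<close> handles the inner integral.\<close>

lemma kelvin_kernel_eq:
  assumes "0 < x"
  shows "kelvin_kernel \<tau> x = (\<integral>u. exp (\<i> * of_real (2 * \<tau> * u)) *
    (\<integral>d. exp (- of_real (4 * x powr (1/4) * sqrt (cosh u) * cosh d)) \<partial>lborel) \<partial>lborel) / 4"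
proof -
  define z where "z = 2 * (4 * x) powr (1/4)"
  define X where "X = of_real z * exp (of_real pi * \<i> / 4)"
  define Y where "Y = of_real z * exp (- (of_real pi * \<i> / 4))"
  define \<mu> where "\<mu> = \<i> * of_real (2 * \<tau>)"
  define w where "w = 4 * x powr (1/4)"
  have z: "0 < z" and w: "0 < w" using assms by (auto simp: z_def w_def)
  \<comment> \<open>With this scaling the rotations of \<open>z\<close> by 45 degrees in both
    directions are \<open>w / 2\<close> times \<open>1 + \<i>\<close> and
    \<open>1 - \<i>\<close>.\<close>
  have zw: "z * sqrt 2 = w"
  proof -
    have "(4::real) powr (1/4) = sqrt 2"
      using powr_powr[of 2 2 "1/4"] by (simp add: powr_half_sqrt)
    then show ?thesis using assms by (simp add: z_def w_def powr_mult)
  qed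
  have XY: "X = of_real (w / 2) * (1 + \<i>)" "Y = of_real (w / 2) * (1 - \<i>)"
    using zw by (auto simp: X_def Y_def complex_eq_iff Re_exp Im_exp cos_45 sin_45)
  then have Re: "0 < Re X" "0 < Re Y" using w by (simp_all only: Re_complex_of_real mult.commute, simp_all)
  have "kelvin_kernel \<tau> x = (kelvin_ker \<mu> z + \<i> * kelvin_kei \<mu> z) * (kelvin_ker \<mu> z - \<i> * kelvin_kei \<mu> z)"
    by (simp add: kelvin_kernel_def power2_eq_square algebra_simps z_def \<mu>_def)
  also have "\<dots> = (exp (- (\<mu> * of_real pi * \<i> / 2)) * exp (\<mu> * of_real pi * \<i> / 2)) * (bessel_K \<mu> X * bessel_K \<mu> Y)"
    using kelvin_equations_iff[of "kelvin_ker \<mu> z" "kelvin_kei \<mu> z" \<mu> z] by (simp add: X_def Y_def)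
  also have "\<dots> = bessel_K \<mu> X * bessel_K \<mu> Y"
    by (simp add: mult_exp_exp)
  also have "\<dots> = (\<integral>a. exp (- X * cosh (of_real a)) * exp (\<i> * of_real (2 * \<tau>) * of_real a) \<partial>lborel) *
     (\<integral>a. exp (- Y * cosh (of_real a)) * exp (\<i> * of_real (2 * \<tau>) * of_real a) \<partial>lborel) / 4"
    unfolding \<mu>_def bessel_K_eq_integral[OF Re(1)] bessel_K_eq_integral[OF Re(2)] by simp
  also have "\<dots> = (\<integral>u. \<integral>d.
        (exp (- X * cosh (of_real (u / 2 + d))) * exp (\<i> * of_real (2 * \<tau>) * of_real (u / 2 + d))) *
        (exp (- Y * cosh (of_real (u / 2 - d))) * exp (\<i> * of_real (2 * \<tau>) * of_real (u / 2 - d))) \<partial>lborel \<partial>lborel) / 4"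
    using integral_mult_eq_convolution[OF integrable_exp_cosh_oscillating[OF Re(1)]
        integrable_exp_cosh_oscillating[OF Re(2)], of "2 * \<tau>" "2 * \<tau>"] by (simp only:)
  also have "\<dots> = (\<integral>u. exp (\<i> * of_real (2 * \<tau> * u)) *
    (\<integral>d. exp (- of_real (w * sqrt (cosh u) * cosh d)) \<partial>lborel) \<partial>lborel) / 4"
  proof (intro arg_cong[where f = "\<lambda>c. c / 4"] Bochner_Integration.integral_cong refl)
    fix u :: real
    \<comment> \<open>Up to the factor \<open>- w / 2\<close>, the sum of the two
      \<open>cosh\<close> values is the real part of the non-oscillating exponent and their
      difference its imaginary part.\<close>
    have "(exp (- X * cosh (of_real (u / 2 + d))) * exp (\<i> * of_real (2 * \<tau>) * of_real (u / 2 + d))) *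
        (exp (- Y * cosh (of_real (u / 2 - d))) * exp (\<i> * of_real (2 * \<tau>) * of_real (u / 2 - d)))
       = exp (\<i> * of_real (2 * \<tau> * u)) *
       exp (- of_real w * (of_real (cosh (u / 2) * cosh d) + \<i> * of_real (sinh (u / 2) * sinh d)))" for d
      unfolding mult_exp_exp XY of_real_cosh[symmetric] cosh_add cosh_diff
      by (rule arg_cong[where f = exp]) (simp add: algebra_simps complex_eq_iff add_divide_distrib)
    then show "(\<integral>d.
        (exp (- X * cosh (of_real (u / 2 + d))) * exp (\<i> * of_real (2 * \<tau>) * of_real (u / 2 + d))) *
        (exp (- Y * cosh (of_real (u / 2 - d))) * exp (\<i> * of_real (2 * \<tau>) * of_real (u / 2 - d))) \<partial>lborel)
      = exp (\<i> * of_real (2 * \<tau> * u)) * (\<integral>d. exp (- of_real (w * sqrt (cosh u) * cosh d)) \<partial>lborel)"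
      using LBINT_exp_cosh_sinh[OF w, of "u / 2"] by simp
  qed
  finally show ?thesis by (simp add: w_def)
qed

section \<open>The kernel as an integral over the plane\<close>

lemma nn_integral_lborel_times:
  fixes f g :: "real \<Rightarrow> ennreal"
  assumes [measurable]: "f \<in> borel_measurable borel" "g \<in> borel_measurable borel"
  shows "(\<integral>\<^sup>+z. f (fst z) * g (snd z) \<partial>lborel) = (\<integral>\<^sup>+u. f u \<partial>lborel) * (\<integral>\<^sup>+v. g v \<partial>lborel)"
  unfolding lborel_prod[symmetric]
  by (subst lborel.nn_integral_fst[symmetric]) (auto simp: nn_integral_cmult nn_integral_multc)

text \<open>A function on the plane instead of an iterated integral, so that Fubini and dominated
  convergence treat both variables at once. It enters the kernel with
  \<open>c = 4 * x powr (1/4)\<close>.\<close>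

definition kernel_weight :: "real \<Rightarrow> real \<times> real \<Rightarrow> real" where
  "kernel_weight c z = exp (- (c * (sqrt (cosh (fst z)) * cosh (snd z))))"

lemma kernel_weight_pos [simp]: "0 < kernel_weight c z"
  and kernel_weight_nonneg [simp]: "0 \<le> kernel_weight c z"
  by (auto simp: kernel_weight_def)

lemma measurable_fst_borel [measurable]: "fst \<in> (borel :: (real \<times> real) measure) \<rightarrow>\<^sub>M borel"
  and measurable_snd_borel [measurable]: "snd \<in> (borel :: (real \<times> real) measure) \<rightarrow>\<^sub>M borel"
  by (intro borel_measurable_continuous_onI continuous_intros)+

lemma measurable_kernel_weight [measurable (raw)]:
  assumes [measurable]: "g \<in> M \<rightarrow>\<^sub>M borel" "h \<in> M \<rightarrow>\<^sub>M borel"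
  shows "(\<lambda>x. kernel_weight (g x) (h x)) \<in> borel_measurable M"
  unfolding kernel_weight_def by measurable

text \<open>The power separates the variables into two \<open>cosh\<close> integrals. The factor
  \<open>4\<close> is kept apart because it cancels the \<open>1/4\<close> of the kernel; for
  \<open>s = 4 * (1 - \<nu>)\<close> the other power is \<open>4 powr (\<nu> - 3)\<close>.\<close>

lemma nn_integral_kernel_scale_powr:
  assumes "0 < s"
  shows "(\<integral>\<^sup>+z. ennreal ((4 * (sqrt (cosh (fst z)) * cosh (snd z))) powr - s) \<partial>lborel)
    = ennreal (4 * 4 powr (- (s / 4) - 2) * Beta (s / 4) (s / 4) * Beta (s / 2) (s / 2))"
proof -
  have "(4 * (sqrt (cosh u) * cosh v)) powr - s = 4 powr - s * (cosh u powr - (s / 2) * cosh v powr - s)" for u v :: real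
    by (simp add: powr_mult powr_powr flip: powr_half_sqrt)
  then have "(\<integral>\<^sup>+z. ennreal ((4 * (sqrt (cosh (fst z)) * cosh (snd z))) powr - s) \<partial>lborel)
    = (\<integral>\<^sup>+z. ennreal (4 powr - s) * (ennreal (cosh (fst z) powr - (s / 2)) * ennreal (cosh (snd z) powr - s)) \<partial>lborel)"
    by (simp add: ennreal_mult)
  also have "\<dots> = ennreal (4 powr - s) * ((\<integral>\<^sup>+u. ennreal (cosh u powr - (s / 2)) \<partial>lborel) * (\<integral>\<^sup>+v. ennreal (cosh v powr - s) \<partial>lborel))"
    by (subst nn_integral_cmult) (auto simp: nn_integral_lborel_times[of "\<lambda>u. ennreal (cosh u powr - (s / 2))" "\<lambda>v. ennreal (cosh v powr - s)"])
  also have "\<dots> = ennreal (4 powr - s * ((2 powr (s / 2 - 1) * Beta (s / 4) (s / 4)) * (2 powr (s - 1) * Beta (s / 2) (s / 2))))"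
  proof -
    have [simp]: "0 \<le> Beta (s / 4) (s / 4)" "0 \<le> Beta (s / 2) (s / 2)"
      using assms by (auto intro: Beta_real_nonneg)
    show ?thesis
      using assms nn_integral_cosh_powr[of "s / 2"] nn_integral_cosh_powr[of s]
      by (simp add: ennreal_mult)
  qed
  also have "4 powr - s * ((2 powr (s / 2 - 1) * Beta (s / 4) (s / 4)) * (2 powr (s - 1) * Beta (s / 2) (s / 2)))
     = (4 powr - s * (2 powr (s / 2 - 1) * 2 powr (s - 1))) * Beta (s / 4) (s / 4) * Beta (s / 2) (s / 2)"
    by simp
  also have "4 powr - s * (2 powr (s / 2 - 1) * 2 powr (s - 1)) = 4 * 4 powr (- (s / 4) - 2)"
  proof -
    have four: "4 powr r = 2 powr (2 * r)" for r :: real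
      using powr_powr[of 2 2 r] by simp
    have "4 powr - s * (2 powr (s / 2 - 1) * 2 powr (s - 1)) = 2 powr (2 * - s + (s / 2 - 1 + (s - 1)))"
      unfolding four powr_add ..
    also have "2 * - s + (s / 2 - 1 + (s - 1)) = 2 + 2 * (- (s / 4) - 2)"
      by (simp add: field_simps)
    finally show ?thesis
      unfolding four powr_add by simp
  qed
  finally show ?thesis .
qed

text \<open>Again \<open>exp (- t) \<le> 1 / t\<close> for positive \<open>t\<close>, now compared
  with the case \<open>s = 1\<close> of the preceding integral; \<open>4 / c\<close> offsets the
  \<open>4\<close> inside it.\<close>

lemma integrable_kernel_weight:
  assumes "0 < c"
  shows "integrable lborel (kernel_weight c)"
proof (rule Bochner_Integration.integrable_bound)
  have "integrable lborel (\<lambda>z. (4 * (sqrt (cosh (fst z)) * cosh (snd z))) powr - 1)"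
    using nn_integral_kernel_scale_powr[of 1] by (intro integrableI_nn_integral_finite) auto
  then show "integrable lborel (\<lambda>z. (4 / c) * (4 * (sqrt (cosh (fst z)) * cosh (snd z))) powr - 1)"
    by (rule integrable_mult_right)
  show "AE z in lborel. norm (kernel_weight c z) \<le> norm ((4 / c) * (4 * (sqrt (cosh (fst z)) * cosh (snd z))) powr - 1)"
  proof (intro AE_I2)
    fix z :: "real \<times> real"
    define y where "y = sqrt (cosh (fst z)) * cosh (snd z)"
    have y: "0 < y" by (simp add: y_def)
    have "c * y \<le> exp (c * y)" using exp_ge_add_one_self[of "c * y"] by linarith
    then have "exp (- (c * y)) \<le> 1 / (c * y)"
      using assms y by (simp add: exp_minus field_simps)
    then show "norm (kernel_weight c z) \<le> norm ((4 / c) * (4 * (sqrt (cosh (fst z)) * cosh (snd z))) powr - 1)"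
      unfolding kernel_weight_def y_def[symmetric] using assms y by (simp add: powr_minus field_simps)
  qed
qed measurable

lemma kelvin_kernel_eq_weight:
  assumes "0 < x"
  shows "kelvin_kernel \<tau> x =
    (\<integral>z. cis (2 * \<tau> * fst z) * of_real (kernel_weight (4 * x powr (1/4)) z) \<partial>lborel) / 4"
proof -
  let ?h = "\<lambda>u v. cis (2 * \<tau> * u) * of_real (kernel_weight (4 * x powr (1/4)) (u, v))"
  have "integrable lborel (\<lambda>z. ?h (fst z) (snd z))"
    using integrable_kernel_weight[of "4 * x powr (1/4)"] assms
    by (rule_tac Bochner_Integration.integrable_bound) (auto simp: norm_mult cis_conv_exp)
  then have "integrable (lborel \<Otimes>\<^sub>M lborel) (case_prod ?h)"
    by (simp add: lborel_prod case_prod_beta')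
  then have "(\<integral>u. (\<integral>v. ?h u v \<partial>lborel) \<partial>lborel) = (\<integral>z. ?h (fst z) (snd z) \<partial>lborel)"
    using lborel_pair.integral_fst[of ?h] by (simp add: lborel_prod case_prod_beta')
  moreover have "(\<integral>v. ?h u v \<partial>lborel) = exp (\<i> * of_real (2 * \<tau> * u)) *
      (\<integral>d. exp (- of_real (4 * x powr (1/4) * sqrt (cosh u) * cosh d)) \<partial>lborel)" for u
    unfolding cis_conv_exp kernel_weight_def exp_of_real[symmetric] of_real_minus fst_conv snd_conv mult.assoc[of "4 * x powr (1/4)"]
    by (rule integral_mult_right_zero)
  ultimately show ?thesis
    unfolding kelvin_kernel_eq[OF assms] by simp
qed

text \<open>For positive \<open>x\<close> this is the kernel at \<open>\<tau> = 0\<close>, where the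
  \<open>cis\<close> factor is constantly one.\<close>

definition kernel_majorant :: "real \<Rightarrow> real" where
  "kernel_majorant x = (\<integral>z. kernel_weight (4 * x powr (1/4)) z \<partial>lborel) / 4"

lemma kernel_majorant_nonneg: "0 \<le> kernel_majorant x"
  by (simp add: kernel_majorant_def)

lemma norm_kelvin_kernel_le:
  assumes "0 < x"
  shows "norm (kelvin_kernel \<tau> x) \<le> kernel_majorant x"
proof -
  have "norm (\<integral>z. cis (2 * \<tau> * fst z) * of_real (kernel_weight (4 * x powr (1/4)) z) \<partial>lborel)
    \<le> (\<integral>z. kernel_weight (4 * x powr (1/4)) z \<partial>lborel)"
    using integral_norm_bound[of lborel "\<lambda>z. cis (2 * \<tau> * fst z) * of_real (kernel_weight (4 * x powr (1/4)) z)"]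
    by (simp add: norm_mult)
  then show ?thesis
    unfolding kelvin_kernel_eq_weight[OF assms] kernel_majorant_def by (simp add: norm_divide)
qed

section \<open>Continuity and decay of the kernel in \<tau>\<close>

lemma continuous_on_integral_dominated:
  fixes h :: "real \<Rightarrow> 'a \<Rightarrow> 'b::{banach, second_countable_topology}"
  assumes "\<And>t. h t \<in> borel_measurable M" "integrable M w"
    and "\<And>t x. norm (h t x) \<le> w x" "\<And>x. continuous_on UNIV (\<lambda>t. h t x)"
  shows "continuous_on UNIV (\<lambda>t. \<integral>x. h t x \<partial>M)"
proof -
  have "isCont (\<lambda>t. \<integral>x. h t x \<partial>M) t" for t
    unfolding continuous_at_sequentially
  proof (intro allI impI)
    fix X :: "nat \<Rightarrow> real" assume X: "X \<longlonglongrightarrow> t"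
    have "(\<lambda>n. h (X n) x) \<longlonglongrightarrow> h t x" for x
      using continuous_on_tendsto_compose[OF assms(4) X] by simp
    then show "((\<lambda>t. \<integral>x. h t x \<partial>M) \<circ> X) \<longlonglongrightarrow> (\<integral>x. h t x \<partial>M)"
      unfolding o_def using assms(1-3)
      by (intro integral_dominated_convergence[where w = w]) auto
  qed
  then show ?thesis by (simp add: continuous_on_eq_continuous_at)
qed

lemma continuous_on_kelvin_kernel:
  assumes "0 < x"
  shows "continuous_on UNIV (\<lambda>\<tau>. kelvin_kernel \<tau> x)"
  unfolding kelvin_kernel_eq_weight[OF assms]
  using integrable_kernel_weight[of "4 * x powr (1/4)"] assms
  by (intro continuous_on_divide continuous_on_integral_dominated[where w = "kernel_weight (4 * x powr (1/4))"])
     (auto simp: norm_mult cis_conv_exp intro!: continuous_intros)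

text \<open>Because a translation by at most one costs only a constant factor, a single weight with
  smaller \<open>c\<close> dominates all such translates. This supplies the majorant for the decay
  in \<tau>.\<close>

lemma cosh_shift_lower:
  fixes u d :: real
  assumes "0 \<le> d" "d \<le> 1"
  shows "exp (- 1) * cosh u \<le> cosh (u + d)"
proof -
  have "exp (-1) * exp u \<le> exp (u + d)" "exp (-1) * exp (- u) \<le> exp (- (u + d))"
    using assms by (auto simp: mult_exp_exp)
  then show ?thesis by (simp add: cosh_field_def algebra_simps)
qed

text \<open>
  Translating \<open>u\<close> by \<open>\<pi> / (2\<tau>)\<close> changes the sign of \<open>cis (2\<tau>u)\<close>, so the integral is half the
  integral against the difference of the weight and its translate.
\<close>

lemma kelvin_kernel_tendsto_0:
  assumes "0 < x"
  shows "((\<lambda>\<tau>. kelvin_kernel \<tau> x) \<longlongrightarrow> 0) at_top"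
proof -
  define c where "c = 4 * x powr (1/4)"
  have c: "0 < c" using assms by (simp add: c_def)
  \<comment> \<open>The loss \<open>exp (- 1)\<close> in \<open>cosh\<close> sits under a square
    root, hence the \<open>1 / 2\<close>.\<close>
  define c' where "c' = c * exp (- (1 / 2))"
  have c': "0 < c'" using c by (simp add: c'_def)
  define \<delta> where "\<delta> = (\<lambda>\<tau>::real. pi / (2 * \<tau>))"
  define D where "D = (\<lambda>\<tau> z. \<bar>kernel_weight c z - kernel_weight c (z + (\<delta> \<tau>, 0))\<bar>)"
  have le: "kernel_weight c (z + (d, 0)) \<le> kernel_weight c' z" if "0 \<le> d" "d \<le> 1" for z d
  proof -
    have "exp (- (1 / 2)) * sqrt (cosh (fst z)) = sqrt (exp (- 1) * cosh (fst z))"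
    proof -
      have "sqrt (exp (- 1)) = exp (- (1 / 2))"
        by (rule real_sqrt_unique) (simp_all add: power2_eq_square mult_exp_exp)
      then show ?thesis by (simp add: real_sqrt_mult)
    qed
    also have "\<dots> \<le> sqrt (cosh (fst z + d))"
      using cosh_shift_lower[OF that] by simp
    finally have "c * (exp (- (1 / 2)) * sqrt (cosh (fst z)) * cosh (snd z)) \<le> c * (sqrt (cosh (fst z + d)) * cosh (snd z))"
      using c by (intro mult_left_mono mult_right_mono) auto
    then show ?thesis
      by (simp add: kernel_weight_def c'_def mult_ac)
  qed
  have shift: "integrable lborel (\<lambda>z. kernel_weight c (z + (d, 0)))" if "0 \<le> d" "d \<le> 1" for d
    using integrable_kernel_weight[OF c'] le[OF that]
    by (rule_tac Bochner_Integration.integrable_bound) auto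
  \<comment> \<open>For \<open>\<tau> \<ge> pi\<close> the shift is at most \<open>1 / 2\<close>,
    inside the range of \<open>cosh_shift_lower\<close>.\<close>
  have ev: "\<forall>\<^sub>F \<tau> in at_top. 0 < \<tau> \<and> 0 \<le> \<delta> \<tau> \<and> \<delta> \<tau> \<le> 1"
    using eventually_ge_at_top[of pi]
  proof eventually_elim
    case (elim \<tau>)
    then have "0 < \<tau>" using pi_gt_zero by linarith
    then show ?case using elim by (simp add: \<delta>_def divide_simps)
  qed
  \<comment> \<open>Pointwise convergence is continuity of the weight in its first coordinate, as
    the shift tends to zero.\<close>
  have "((\<lambda>\<tau>. \<integral>z. D \<tau> z \<partial>lborel) \<longlongrightarrow> (\<integral>z. 0 \<partial>(lborel :: (real \<times> real) measure))) at_top"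
  proof (rule integral_dominated_convergence_at_top[where w = "\<lambda>z. 2 * kernel_weight c' z"])
    show "integrable lborel (\<lambda>z. 2 * kernel_weight c' z)"
      using integrable_kernel_weight[OF c'] by simp
    show "\<forall>\<^sub>F \<tau> in at_top. AE z in lborel. norm (D \<tau> z) \<le> 2 * kernel_weight c' z"
      using ev
    proof eventually_elim
      case (elim \<tau>)
      show ?case
      proof (intro AE_I2)
        fix z
        have "kernel_weight c z \<le> kernel_weight c' z" using le[of 0 z] by (simp add: prod_eq_iff flip: zero_prod_def)
        moreover have "kernel_weight c (z + (\<delta> \<tau>, 0)) \<le> kernel_weight c' z" using le elim by auto
        moreover have "0 \<le> kernel_weight c z" "0 \<le> kernel_weight c (z + (\<delta> \<tau>, 0))" by simp_all
        ultimately show "norm (D \<tau> z) \<le> 2 * kernel_weight c' z"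
          unfolding D_def real_norm_def by linarith
      qed
    qed
    show "AE z in lborel. ((\<lambda>\<tau>. D \<tau> z) \<longlongrightarrow> 0) at_top"
    proof (intro AE_I2)
      fix z
      have "(\<delta> \<longlongrightarrow> 0) at_top" unfolding \<delta>_def by real_asymp
      then have "((\<lambda>\<tau>. \<bar>kernel_weight c z - exp (- (c * (sqrt (cosh (fst z + \<delta> \<tau>)) * cosh (snd z))))\<bar>)
        \<longlongrightarrow> \<bar>kernel_weight c z - exp (- (c * (sqrt (cosh (fst z + 0)) * cosh (snd z))))\<bar>) at_top"
        by (intro tendsto_intros)
      then show "((\<lambda>\<tau>. D \<tau> z) \<longlongrightarrow> 0) at_top"
        by (simp add: D_def kernel_weight_def)
    qed
  qed (auto simp: D_def)
  then have lim: "((\<lambda>\<tau>. (\<integral>z. D \<tau> z \<partial>lborel) / 8) \<longlongrightarrow> 0) at_top"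
    by (auto intro: tendsto_divide_zero)
  have "\<forall>\<^sub>F \<tau> in at_top. norm (kelvin_kernel \<tau> x) \<le> (\<integral>z. D \<tau> z \<partial>lborel) / 8"
    using ev
  proof eventually_elim
    case (elim \<tau>)
    let ?h = "\<lambda>z. cis (2 * \<tau> * fst z) * of_real (kernel_weight c z)"
    let ?k = "\<lambda>z. cis (2 * \<tau> * fst z) * of_real (kernel_weight c (z + (\<delta> \<tau>, 0)))"
    have h: "integrable lborel ?h"
      using integrable_kernel_weight[OF c]
      by (rule Bochner_Integration.integrable_bound) (auto simp: norm_mult cis_conv_exp)
    have k: "integrable lborel ?k"
      using shift[of "\<delta> \<tau>"] elim
      by (rule_tac Bochner_Integration.integrable_bound) (auto simp: norm_mult cis_conv_exp)
    have "(\<integral>z. ?h z \<partial>lborel) = (\<integral>z. ?h ((\<delta> \<tau>, 0) + z) \<partial>lborel)"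
    proof -
      have "(\<integral>z. ?h z \<partial>lborel) = (\<integral>z. ?h z \<partial>distr lborel borel ((+) (\<delta> \<tau>, 0)))"
        by (simp add: lborel_distr_plus)
      also have "\<dots> = (\<integral>z. ?h ((\<delta> \<tau>, 0) + z) \<partial>lborel)"
        by (rule integral_distr) (auto simp: cis_conv_exp)
      finally show ?thesis .
    qed
    also have "\<dots> = (\<integral>z. - ?k z \<partial>lborel)"
    proof (rule Bochner_Integration.integral_cong[OF refl])
      fix z :: "real \<times> real"
      have "2 * \<tau> * (fst z + \<delta> \<tau>) = pi + 2 * \<tau> * fst z"
        using elim by (simp add: \<delta>_def field_simps)
      then have "?h ((\<delta> \<tau>, 0) + z) = cis (pi + 2 * \<tau> * fst z) * of_real (kernel_weight c (z + (\<delta> \<tau>, 0)))"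
        by (simp only: fst_add fst_conv add.commute[of "(\<delta> \<tau>, 0)" z])
      also have "cis (pi + 2 * \<tau> * fst z) = - cis (2 * \<tau> * fst z)"
        by (simp add: complex_eq_iff)
      finally show "?h ((\<delta> \<tau>, 0) + z) = - ?k z"
        by simp
    qed
    finally have eq: "(\<integral>z. ?h z \<partial>lborel) = - (\<integral>z. ?k z \<partial>lborel)"
      by simp
    \<comment> \<open>From \<open>a = - b\<close> follows \<open>a = (a - b) / 2\<close>; this
      \<open>2\<close> and the \<open>4\<close> of the kernel make \<open>8\<close>.\<close>
    have half: "norm (a / 4) \<le> N / 8" if "a = - b" "norm (a - b) \<le> N" for a b :: complex and N
      using that by (simp add: norm_mult norm_divide flip: mult_2)
    have D: "norm (?h z - ?k z) = D \<tau> z" for z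
    proof -
      have "?h z - ?k z = cis (2 * \<tau> * fst z) * of_real (kernel_weight c z - kernel_weight c (z + (\<delta> \<tau>, 0)))"
        by (simp add: right_diff_distrib)
      then show ?thesis
        by (simp only: norm_mult norm_of_real norm_cis D_def mult_1)
    qed
    have "norm (\<integral>z. ?h z - ?k z \<partial>lborel) \<le> (\<integral>z. D \<tau> z \<partial>lborel)"
      using integral_norm_bound[of lborel "\<lambda>z. ?h z - ?k z"] unfolding D .
    then have "norm ((\<integral>z. ?h z \<partial>lborel) - (\<integral>z. ?k z \<partial>lborel)) \<le> (\<integral>z. D \<tau> z \<partial>lborel)"
      unfolding Bochner_Integration.integral_diff[OF h k] .
    from half[OF eq this] show ?case
      unfolding kelvin_kernel_eq_weight[OF assms] c_def[symmetric] .
  qed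
  then show ?thesis
    using lim by (rule Lim_null_comparison)
qed

section \<open>The index transform\<close>

text \<open>Functions in \<open>weighted_Lp\<close> are only Lebesgue measurable, so Fubini is
  applied with the completed measure in \<open>x\<close>. A countable Borel cover for
  \<open>lborel\<close> serves again, since completion keeps the measure of Borel sets.\<close>

lemma sigma_finite_lebesgue: "sigma_finite_measure (lebesgue :: real measure)"
proof
  obtain A :: "real set set" where A: "countable A" "A \<subseteq> sets lborel" "\<Union>A = space lborel" "\<forall>a\<in>A. emeasure lborel a \<noteq> \<infinity>"
    using lborel.sigma_finite_countable by blast
  then show "\<exists>A::real set set. countable A \<and> A \<subseteq> sets lebesgue \<and> \<Union>A = space lebesgue \<and> (\<forall>a\<in>A. emeasure lebesgue a \<noteq> \<infinity>)"
    by (intro exI[of _ A]) (auto simp: sets_completionI_sets)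
qed

lemma measurable_powr_lebesgue: "(\<lambda>x::real. x powr r) \<in> borel_measurable lebesgue"
  by (intro measurable_completion) auto

text \<open>Exchanging the order puts the integral in \<open>x\<close> innermost, where the weight
  reads \<open>exp (- (c z * x powr (1/4)))\<close> and Hoelder's inequality applies for fixed
  \<open>z\<close>. There remains the integral of \<open>c z powr - s\<close> over the plane. With
  nonnegative integrals the exchange is legitimate before finiteness is known.\<close>

lemma kernel_majorant_bound:
  assumes "1 \<le> p" "\<nu> < 1" and f: "f \<in> weighted_Lp \<nu> p"
  shows "(\<integral>\<^sup>+x. ennreal (kernel_majorant x * norm (f x)) * indicator {0<..} x \<partial>lebesgue)
    \<le> ennreal (index_const \<nu> p * weighted_Lp_norm \<nu> p f)"
proof -
  interpret sigma_finite_measure "lebesgue :: real measure" by (rule sigma_finite_lebesgue)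
  interpret P: pair_sigma_finite "lebesgue :: real measure" "lborel :: (real \<times> real) measure" ..
  define s where "s = 4 * (1 - \<nu>)"
  have s: "0 < s" using assms by (simp add: s_def)
  define N where "N = weighted_Lp_norm \<nu> p f"
  have N: "0 \<le> N" by (simp add: N_def weighted_Lp_norm_def)
  define g where "g = (\<lambda>x. indicat_real {0<..} x *\<^sub>R f x)"
  define c where "c = (\<lambda>z::real \<times> real. 4 * (sqrt (cosh (fst z)) * cosh (snd z)))"
  have c: "0 < c z" for z by (simp add: c_def)
  define H where "H = (\<lambda>x z. ennreal (kernel_weight (4 * x powr (1/4)) z * norm (g x) / 4))"
  have g: "g \<in> borel_measurable lebesgue"
    using f by (simp add: weighted_Lp_def set_borel_measurable_def g_def)
  have H: "case_prod H \<in> borel_measurable (lebesgue \<Otimes>\<^sub>M lborel)"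
  proof -
    have [measurable]: "(\<lambda>q. fst q powr (1/4 :: real)) \<in> borel_measurable (lebesgue \<Otimes>\<^sub>M (lborel :: (real \<times> real) measure))"
      "(\<lambda>q. g (fst q)) \<in> borel_measurable (lebesgue \<Otimes>\<^sub>M (lborel :: (real \<times> real) measure))"
      using measurable_compose[OF measurable_fst measurable_powr_lebesgue] measurable_compose[OF measurable_fst g] by auto
    show ?thesis
      unfolding H_def case_prod_beta' by measurable
  qed
  have "(\<integral>\<^sup>+x. ennreal (kernel_majorant x * norm (f x)) * indicator {0<..} x \<partial>lebesgue)
     = (\<integral>\<^sup>+x. (\<integral>\<^sup>+z. H x z \<partial>lborel) \<partial>lebesgue)"
  proof (rule nn_integral_cong)
    fix x :: real
    show "ennreal (kernel_majorant x * norm (f x)) * indicator {0<..} x = (\<integral>\<^sup>+z. H x z \<partial>lborel)"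
    proof (cases "0 < x")
      case True
      then have "integrable lborel (kernel_weight (4 * x powr (1/4)))"
        by (intro integrable_kernel_weight) auto
      then show ?thesis
        using True unfolding H_def kernel_majorant_def
        by (subst nn_integral_eq_integral) (auto simp: g_def)
    qed (auto simp: H_def g_def)
  qed
  also have "\<dots> = (\<integral>\<^sup>+z. (\<integral>\<^sup>+x. H x z \<partial>lebesgue) \<partial>lborel)"
    by (rule P.Fubini'[symmetric, OF H])
  also have "\<dots> \<le> (\<integral>\<^sup>+z. ennreal (holder_const \<nu> p * N / 4) * ennreal (c z powr - s) \<partial>lborel)"
  proof (rule nn_integral_mono)
    fix z
    have "(\<integral>\<^sup>+x. H x z \<partial>lebesgue) = (\<integral>\<^sup>+x. ennreal (1 / 4) * (ennreal (exp (- (c z * x powr (1/4))) * norm (f x)) * indicator {0<..} x) \<partial>lebesgue)"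
      by (intro nn_integral_cong)
         (auto simp: H_def g_def kernel_weight_def c_def mult_ac indicator_def simp flip: ennreal_mult')
    also have "\<dots> = ennreal (1 / 4) * (\<integral>\<^sup>+x. (ennreal (exp (- (c z * x powr (1/4))) * norm (f x)) * indicator {0<..} x) \<partial>lebesgue)"
    proof (rule nn_integral_cmult)
      have "(\<lambda>x. ennreal (exp (- (c z * x powr (1/4))) * norm (g x))) \<in> borel_measurable lebesgue"
        using measurable_powr_lebesgue[of "1/4"] g by measurable
      moreover have "ennreal (exp (- (c z * x powr (1/4))) * norm (g x))
          = ennreal (exp (- (c z * x powr (1/4))) * norm (f x)) * indicator {0<..} x" for x
        by (auto simp: g_def indicator_def)
      ultimately show "(\<lambda>x. ennreal (exp (- (c z * x powr (1/4))) * norm (f x)) * indicator {0<..} x) \<in> borel_measurable lebesgue"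
        by simp
    qed
    also have "\<dots> \<le> ennreal (1 / 4) * ennreal (holder_const \<nu> p * c z powr - s * N)"
      unfolding N_def s_def by (intro mult_left_mono exp_weighted_bound assms c) auto
    also have "\<dots> = ennreal (holder_const \<nu> p * N / 4) * ennreal (c z powr - s)"
      using N by (simp add: holder_const_nonneg mult_ac flip: ennreal_mult')
    finally show "(\<integral>\<^sup>+x. H x z \<partial>lebesgue) \<le> ennreal (holder_const \<nu> p * N / 4) * ennreal (c z powr - s)" .
  qed
  also have "\<dots> = ennreal (holder_const \<nu> p * N / 4) * (\<integral>\<^sup>+z. ennreal (c z powr - s) \<partial>lborel)"
    unfolding c_def by (intro nn_integral_cmult) measurable
  also have "\<dots> = ennreal (holder_const \<nu> p * N / 4 * (4 * 4 powr (- (s / 4) - 2) * Beta (s / 4) (s / 4) * Beta (s / 2) (s / 2)))"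
    unfolding c_def nn_integral_kernel_scale_powr[OF s]
    using N by (subst ennreal_mult') (simp_all add: holder_const_nonneg)
  also have "holder_const \<nu> p * N / 4 * (4 * 4 powr (- (s / 4) - 2) * Beta (s / 4) (s / 4) * Beta (s / 2) (s / 2))
     = index_const \<nu> p * N"
  proof -
    have "s / 4 = 1 - \<nu>" "s / 2 = 2 * (1 - \<nu>)" "- (1 - \<nu>) - 2 = \<nu> - 3" by (auto simp: s_def)
    then show ?thesis unfolding index_const_eq[OF assms(1,2)]
      by (simp only:) simp
  qed
  finally show ?thesis by (simp add: N_def)
qed

section \<open>Measurability and integrability of the integrand\<close>

lemma measurable_majorant_mult:
  assumes f: "f \<in> weighted_Lp \<nu> p"
  shows "(\<lambda>x. indicator {0<..} x *\<^sub>R (kernel_majorant x * norm (f x))) \<in> borel_measurable lebesgue"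
proof -
  have g: "(\<lambda>x. indicator {0<..} x *\<^sub>R f x) \<in> borel_measurable lebesgue"
    using f by (simp add: weighted_Lp_def set_borel_measurable_def)
  have "kernel_majorant \<in> borel_measurable lborel"
    unfolding kernel_majorant_def by measurable
  then have k: "kernel_majorant \<in> borel_measurable lebesgue"
    by (rule measurable_completion)
  have "(\<lambda>x. kernel_majorant x * norm (indicator {0<..} x *\<^sub>R f x)) \<in> borel_measurable lebesgue"
    using g k by measurable
  also have "(\<lambda>x. kernel_majorant x * norm (indicator {0<..} x *\<^sub>R f x)) =
      (\<lambda>x. indicator {0<..} x *\<^sub>R (kernel_majorant x * norm (f x)))"
    by (auto simp: indicator_def)
  finally show ?thesis .
qed

lemma measurable_transform_integrand:
  assumes f: "f \<in> weighted_Lp \<nu> p"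
  shows "(\<lambda>x. indicator {0<..} x *\<^sub>R (kelvin_kernel \<tau> x * f x)) \<in> borel_measurable lebesgue"
proof -
  have g: "(\<lambda>x. indicator {0<..} x *\<^sub>R f x) \<in> borel_measurable lebesgue"
    using f by (simp add: weighted_Lp_def set_borel_measurable_def)
  \<comment> \<open>The plane integral represents \<open>kelvin_kernel\<close> for positive
    \<open>x\<close>; \<open>k\<close> is that integral for all \<open>x\<close>, and the indicator
    hides any difference elsewhere.\<close>
  define k where "k = (\<lambda>x. (\<integral>z. cis (2 * \<tau> * fst z) * of_real (kernel_weight (4 * x powr (1/4)) z) \<partial>lborel) / 4)"
  have "k \<in> borel_measurable lborel"
    unfolding k_def cis_conv_exp by measurable
  then have k: "k \<in> borel_measurable lebesgue"
    by (rule measurable_completion)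
  have "(\<lambda>x. k x * (indicator {0<..} x *\<^sub>R f x)) \<in> borel_measurable lebesgue"
    using g k by measurable
  also have "(\<lambda>x. k x * (indicator {0<..} x *\<^sub>R f x)) =
      (\<lambda>x. indicator {0<..} x *\<^sub>R (kelvin_kernel \<tau> x * f x))"
  proof
    fix x :: real
    show "k x * (indicator {0<..} x *\<^sub>R f x) = indicator {0<..} x *\<^sub>R (kelvin_kernel \<tau> x * f x)"
      by (cases "0 < x") (simp_all add: k_def kelvin_kernel_eq_weight)
  qed
  finally show ?thesis .
qed

lemma majorant_mult_integrable:
  assumes "1 \<le> p" "\<nu> < 1" and f: "f \<in> weighted_Lp \<nu> p"
  shows "integrable lebesgue (\<lambda>x. indicator {0<..} x *\<^sub>R (kernel_majorant x * norm (f x)))"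
    and "(\<integral>x. indicator {0<..} x *\<^sub>R (kernel_majorant x * norm (f x)) \<partial>lebesgue)
      \<le> index_const \<nu> p * weighted_Lp_norm \<nu> p f"
proof -
  let ?m = "\<lambda>x. indicat_real {0<..} x *\<^sub>R (kernel_majorant x * norm (f x))"
  have nn: "0 \<le> ?m x" for x by (simp add: kernel_majorant_nonneg indicator_def)
  have "(\<integral>\<^sup>+x. ennreal (?m x) \<partial>lebesgue)
     = (\<integral>\<^sup>+x. ennreal (kernel_majorant x * norm (f x)) * indicator {0<..} x \<partial>lebesgue)"
    by (intro nn_integral_cong) (auto simp: indicator_def)
  then have le: "(\<integral>\<^sup>+x. ennreal (?m x) \<partial>lebesgue) \<le> ennreal (index_const \<nu> p * weighted_Lp_norm \<nu> p f)"
    using kernel_majorant_bound[OF assms] by simp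
  then show int: "integrable lebesgue ?m"
    by (intro integrableI_nonneg measurable_majorant_mult[OF f])
       (auto simp: nn kernel_majorant_nonneg intro: le_less_trans)
  \<comment> \<open>Since \<open>ennreal\<close> sends negative numbers to zero, the real inequality
    follows from the extended one only once the right side is known to be nonnegative.\<close>
  have "0 \<le> index_const \<nu> p * weighted_Lp_norm \<nu> p f"
  proof -
    have "0 \<le> Beta (1 - \<nu>) (1 - \<nu>)" "0 \<le> Beta (2 * (1 - \<nu>)) (2 * (1 - \<nu>))"
      using assms by (auto intro: Beta_real_nonneg)
    then show ?thesis
      using assms by (simp add: index_const_eq holder_const_nonneg weighted_Lp_norm_def)
  qed
  then show "(\<integral>x. ?m x \<partial>lebesgue) \<le> index_const \<nu> p * weighted_Lp_norm \<nu> p f"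
    using le nn_integral_eq_integral[OF int] nn by simp
qed

lemma transform_integrand_le:
  "norm (indicator {0<..} x *\<^sub>R (kelvin_kernel \<tau> x * f x))
    \<le> indicator {0<..} x *\<^sub>R (kernel_majorant x * norm (f x))"
  using norm_kelvin_kernel_le[of x \<tau>] by (auto simp: indicator_def norm_mult intro: mult_right_mono)

lemma transform_integrand_integrable:
  assumes "1 \<le> p" "\<nu> < 1" and f: "f \<in> weighted_Lp \<nu> p"
  shows "set_integrable lebesgue {0<..} (\<lambda>x. kelvin_kernel \<tau> x * f x)"
  unfolding set_integrable_def
  using majorant_mult_integrable(1)[OF assms] measurable_transform_integrand[OF f]
  by (rule Bochner_Integration.integrable_bound)
     (intro AE_I2 order_trans[OF transform_integrand_le], simp)

lemma norm_index_transform_le: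
  assumes "1 \<le> p" "\<nu> < 1" and f: "f \<in> weighted_Lp \<nu> p"
  shows "norm (index_transform f \<tau>) \<le> index_const \<nu> p * weighted_Lp_norm \<nu> p f"
proof -
  have "norm (index_transform f \<tau>) \<le> (\<integral>x. indicator {0<..} x *\<^sub>R (kernel_majorant x * norm (f x)) \<partial>lebesgue)"
    unfolding index_transform_def set_lebesgue_integral_def
    using transform_integrand_integrable[OF assms] majorant_mult_integrable(1)[OF assms]
    by (intro Bochner_Integration.integral_norm_bound_integral transform_integrand_le) (auto simp: set_integrable_def)
  then show ?thesis using majorant_mult_integrable(2)[OF assms] by linarith
qed

lemma continuous_on_index_transform:
  assumes "1 \<le> p" "\<nu> < 1" and f: "f \<in> weighted_Lp \<nu> p"
  shows "continuous_on UNIV (index_transform f)"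
proof -
  have "continuous_on UNIV (\<lambda>\<tau>. indicat_real {0<..} x *\<^sub>R (kelvin_kernel \<tau> x * f x))" for x
    by (cases "0 < x") (auto intro!: continuous_intros continuous_on_kelvin_kernel)
  then have "continuous_on UNIV (\<lambda>\<tau>. \<integral>x. indicator {0<..} x *\<^sub>R (kelvin_kernel \<tau> x * f x) \<partial>lebesgue)"
    by (intro continuous_on_integral_dominated[where
          w = "\<lambda>x. indicator {0<..} x *\<^sub>R (kernel_majorant x * norm (f x))"]
          measurable_transform_integrand[OF f] majorant_mult_integrable(1)[OF assms] transform_integrand_le)
  then show ?thesis
    by (simp add: index_transform_def[abs_def] set_lebesgue_integral_def)
qed

lemma index_transform_tendsto_0:
  assumes "1 \<le> p" "\<nu> < 1" and f: "f \<in> weighted_Lp \<nu> p"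
  shows "(index_transform f \<longlongrightarrow> 0) at_top"
proof -
  have "((\<lambda>\<tau>. \<integral>x. indicator {0<..} x *\<^sub>R (kelvin_kernel \<tau> x * f x) \<partial>lebesgue)
      \<longlongrightarrow> (\<integral>x. 0 \<partial>(lebesgue :: real measure))) at_top"
  proof (rule integral_dominated_convergence_at_top[OF _ _ majorant_mult_integrable(1)[OF assms]])
    show "AE x in lebesgue. ((\<lambda>\<tau>. indicat_real {0<..} x *\<^sub>R (kelvin_kernel \<tau> x * f x)) \<longlongrightarrow> 0) at_top"
    proof (intro AE_I2)
      fix x :: real
      show "((\<lambda>\<tau>. indicat_real {0<..} x *\<^sub>R (kelvin_kernel \<tau> x * f x)) \<longlongrightarrow> 0) at_top"
        by (cases "0 < x") (auto intro: tendsto_mult_left_zero kelvin_kernel_tendsto_0)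
    qed
  qed (use transform_integrand_le measurable_transform_integrand[OF f] in auto)
  then show ?thesis
    by (simp add: index_transform_def[abs_def] set_lebesgue_integral_def)
qed

text \<open>The pointwise bound is uniform in \<tau>, so it passes to the supremum over the nonempty
  half-line.\<close>

lemma Cb_pos_norm_index_transform_le:
  assumes "1 \<le> p" "\<nu> < 1" and f: "f \<in> weighted_Lp \<nu> p"
  shows "Cb_pos_norm (index_transform f) \<le> index_const \<nu> p * weighted_Lp_norm \<nu> p f"
  unfolding Cb_pos_norm_def
  by (rule cSUP_least) (auto intro: norm_index_transform_le[OF assms])

lemma bounded_operator_index_transform:
  assumes "1 \<le> p" "\<nu> < 1"
  shows "bounded_operator_Lp_Cb \<nu> p index_transform"
  unfolding bounded_operator_Lp_Cb_def
proof (intro conjI ballI allI impI)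
  fix f assume f: "f \<in> weighted_Lp \<nu> p"
  have "bounded (index_transform f ` {0<..})"
    by (rule boundedI) (auto intro: norm_index_transform_le[OF assms f])
  then show "index_transform f \<in> Cb_pos"
    using continuous_on_subset[OF continuous_on_index_transform[OF assms f]] by (simp add: Cb_pos_def)
  fix g assume g: "g \<in> weighted_Lp \<nu> p"
  {
    fix \<tau> :: real
    assume ae: "AE x in lebesgue. 0 < x \<longrightarrow> f x = g x"
    have "AE x in lebesgue. indicator {0<..} x *\<^sub>R (kelvin_kernel \<tau> x * f x)
        = indicator {0<..} x *\<^sub>R (kelvin_kernel \<tau> x * g x)"
      using ae by eventually_elim (auto simp: indicator_def)
    then show "index_transform f \<tau> = index_transform g \<tau>"
      unfolding index_transform_def set_lebesgue_integral_def
      by (intro integral_cong_AE measurable_transform_integrand[OF f] measurable_transform_integrand[OF g])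
  }
  fix a b \<tau>
  have "index_transform (\<lambda>x. a * f x + b * g x) \<tau>
    = (LINT x:{0<..}|lebesgue. a * (kelvin_kernel \<tau> x * f x) + b * (kelvin_kernel \<tau> x * g x))"
    by (simp add: index_transform_def algebra_simps)
  also have "\<dots> = a * index_transform f \<tau> + b * index_transform g \<tau>"
    using transform_integrand_integrable[OF assms f, of \<tau>] transform_integrand_integrable[OF assms g, of \<tau>]
    by (subst set_integral_add) (auto simp: index_transform_def)
  finally show "index_transform (\<lambda>x. a * f x + b * g x) \<tau> = a * index_transform f \<tau> + b * index_transform g \<tau>" .
next
  show "\<exists>C. \<forall>f\<in>weighted_Lp \<nu> p. Cb_pos_norm (index_transform f) \<le> C * weighted_Lp_norm \<nu> p f"
    using Cb_pos_norm_index_transform_le[OF assms] by blast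
qed

text \<open>The integrability clause expresses that the transform is well defined: the Bochner
  integral in \<open>index_transform\<close> takes the default value 0 for a non-integrable
  integrand, so its existence has to be asserted separately.\<close>

theorem theorem2:
  fixes p \<nu> :: real
  assumes "1 \<le> p" and "\<nu> < 1"
  shows "(\<forall>f\<in>weighted_Lp \<nu> p. \<forall>\<tau>>0.
            set_integrable lebesgue {0<..} (\<lambda>x. kelvin_kernel \<tau> x * f x)) \<and>
         bounded_operator_Lp_Cb \<nu> p index_transform \<and>
         (\<forall>f\<in>weighted_Lp \<nu> p.
            Cb_pos_norm (index_transform f) \<le> index_const \<nu> p * weighted_Lp_norm \<nu> p f) \<and>
         (\<forall>f\<in>weighted_Lp \<nu> p. (index_transform f \<longlongrightarrow> 0) at_top)"
  using transform_integrand_integrable[OF assms] bounded_operator_index_transform[OF assms]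
    Cb_pos_norm_index_transform_le[OF assms] index_transform_tendsto_0[OF assms]
  by blast

end
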